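(* Let $G$ be a finite group and $A$ a commutative unital ring. Then there are (non-canonical) isomorphisms of $A$-modules $$\text{(1)}\quad \mathrm{Der}(A[G])\cong \mathrm{Inn}(A[G])\oplus\Big(\bigoplus_{[u]\in G^G}\mathrm{Hom}_{Ab}(Z(u),A)\Big),$$ $$\text{(2)}\quad \mathrm{Out}(A[G])\cong \bigoplus_{[u]\in G^G}\mathrm{Hom}_{Ab}(Z(u),A).$$
   Context: $A[G]$ is the group ring. $\mathrm{Der}(A[G])$ is the $A$-module of derivations of $A[G]$: $A$-linear maps $d:A[G]\to A[G]$ with $d(xy)=d(x)y+x\,d(y)$ for all $x,y$. For $a\in A[G]$, $\mathrm{ad}_a(x)=ax-xa$. $\mathrm{Inn}(A[G])$ consists of the finite sums $\sum_{a\in G}C_a\,\mathrm{ad}_a$ with $C_a\in A$, and $\mathrm{Out}(A[G])=\mathrm{Der}(A[G])/\mathrm{Inn}(A[G])$. $G^G$ is the set of conjugacy classes $[u]$ of $G$, with a representative $u$ fixed in each class; $Z(u)$ is the centralizer of $u$ in $G$. For a group $H$, $\mathrm{Hom}_{Ab}(H,A)$ is the $A$-module (pointwise operations) of group homomorphisms from $H$ to the additive group of $A$. *)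

theory Defs
  imports "HOL-Algebra.Module" "HOL-Algebra.Chinese_Remainder" "HOL-Algebra.Group_Action"
begin

text \<open>
  The record type \<open>('a, 'b) module\<close> of HOL-Algebra extends the ring record, so every module below
  also has a multiplication and a one. The locale \<open>module\<close> and the notion of isomorphism
  ignore these two fields; only for the group ring do they matter.
\<close>

definition module_hom ::
    "('a, 'm) ring_scheme \<Rightarrow> ('a, 'b, 'n) module_scheme \<Rightarrow> ('a, 'c, 'k) module_scheme \<Rightarrow> ('b \<Rightarrow> 'c) set"
  where "module_hom R M N = {h \<in> carrier M \<rightarrow> carrier N.
    (\<forall>x \<in> carrier M. \<forall>y \<in> carrier M. h (x \<oplus>\<^bsub>M\<^esub> y) = h x \<oplus>\<^bsub>N\<^esub> h y) \<and>
    (\<forall>c \<in> carrier R. \<forall>x \<in> carrier M. h (c \<odot>\<^bsub>M\<^esub> x) = c \<odot>\<^bsub>N\<^esub> h x)}"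

definition module_isomorphic ::
    "('a, 'm) ring_scheme \<Rightarrow> ('a, 'b, 'n) module_scheme \<Rightarrow> ('a, 'c, 'k) module_scheme \<Rightarrow> bool"
  where "module_isomorphic R M N \<longleftrightarrow> module R M \<and> module R N \<and>
    (\<exists>h \<in> module_hom R M N. bij_betw h (carrier M) (carrier N))"

definition regular_module :: "('a, 'm) ring_scheme \<Rightarrow> ('a, 'a) module"
  where "regular_module R =
    \<lparr>carrier = carrier R, mult = mult R, one = one R, zero = zero R, add = add R,
     smult = mult R\<rparr>"

definition product_module :: "'i set \<Rightarrow> ('i \<Rightarrow> ('a, 'b, 'n) module_scheme) \<Rightarrow> ('a, 'i \<Rightarrow> 'b) module"
  where "product_module I M =
    \<lparr>carrier = (\<Pi>\<^sub>E i\<in>I. carrier (M i)),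
     mult = (\<lambda>x y. \<lambda>i\<in>I. x i \<otimes>\<^bsub>M i\<^esub> y i),
     one = (\<lambda>i\<in>I. \<one>\<^bsub>M i\<^esub>),
     zero = (\<lambda>i\<in>I. \<zero>\<^bsub>M i\<^esub>),
     add = (\<lambda>x y. \<lambda>i\<in>I. x i \<oplus>\<^bsub>M i\<^esub> y i),
     smult = (\<lambda>c x. \<lambda>i\<in>I. c \<odot>\<^bsub>M i\<^esub> x i)\<rparr>"

definition direct_sum_module :: "'i set \<Rightarrow> ('i \<Rightarrow> ('a, 'b, 'n) module_scheme) \<Rightarrow> ('a, 'i \<Rightarrow> 'b) module"
  where "direct_sum_module I M = (product_module I M)
    \<lparr>carrier := {x \<in> \<Pi>\<^sub>E i\<in>I. carrier (M i). finite {i \<in> I. x i \<noteq> \<zero>\<^bsub>M i\<^esub>}}\<rparr>"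

definition binary_sum_module ::
    "('a, 'b, 'n) module_scheme \<Rightarrow> ('a, 'c, 'k) module_scheme \<Rightarrow> ('a, 'b \<times> 'c) module"
  where "binary_sum_module M N = ring.extend (RDirProd M N)
    \<lparr>smult = (\<lambda>c (x, y). (c \<odot>\<^bsub>M\<^esub> x, c \<odot>\<^bsub>N\<^esub> y))\<rparr>"

text \<open>
  The additive part is that of \<^const>\<open>FactRing\<close>, whose carrier consists of the additive cosets of
  \<open>N\<close>. The scalar action is written in the style of \<^const>\<open>rcoset_mult\<close>: for a submodule \<open>N\<close>
  it sends the coset of \<open>x\<close> to the coset of \<open>c \<odot> x\<close>.
\<close>

definition quotient_module :: "('a, 'b, 'n) module_scheme \<Rightarrow> 'b set \<Rightarrow> ('a, 'b set) module"
  where "quotient_module M N = ring.extend (M Quot N)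
    \<lparr>smult = (\<lambda>c X. \<Union>x\<in>X. N +>\<^bsub>M\<^esub> (c \<odot>\<^bsub>M\<^esub> x))\<rparr>"

text \<open>
  \<open>A[G]\<close> is the free module on \<open>G\<close>, an element \<open>\<Sum>\<^sub>g x\<^sub>g g\<close> being the function
  \<open>g \<mapsto> x\<^sub>g\<close> of finite support, with the convolution product. Summing only over the
  support of the left factor makes the product meaningful for infinite \<open>G\<close> as well.
\<close>

definition group_ring :: "('a, 'm) ring_scheme \<Rightarrow> ('g, 'n) monoid_scheme \<Rightarrow> ('a, 'g \<Rightarrow> 'a) module"
  where "group_ring A G = (direct_sum_module (carrier G) (\<lambda>_. regular_module A))
    \<lparr>mult := (\<lambda>x y. \<lambda>g\<in>carrier G.
        \<Oplus>\<^bsub>A\<^esub>h\<in>{h \<in> carrier G. x h \<noteq> \<zero>\<^bsub>A\<^esub>}. x h \<otimes>\<^bsub>A\<^esub> y (inv\<^bsub>G\<^esub> h \<otimes>\<^bsub>G\<^esub> g)),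
     one := (\<lambda>g\<in>carrier G. if g = \<one>\<^bsub>G\<^esub> then \<one>\<^bsub>A\<^esub> else \<zero>\<^bsub>A\<^esub>)\<rparr>"

definition basis_element :: "('a, 'm) ring_scheme \<Rightarrow> ('g, 'n) monoid_scheme \<Rightarrow> 'g \<Rightarrow> ('g \<Rightarrow> 'a)"
  where "basis_element A G a = (\<lambda>g\<in>carrier G. if g = a then \<one>\<^bsub>A\<^esub> else \<zero>\<^bsub>A\<^esub>)"

text \<open>
  Maps between carriers are taken to be extensional, so that equality of maps is equality on the
  carrier; the operations are pointwise.
\<close>

definition Der :: "('a, 'm) ring_scheme \<Rightarrow> ('a, 'b, 'n) module_scheme \<Rightarrow> ('a, 'b \<Rightarrow> 'b) module"
  where "Der A B = (product_module (carrier B) (\<lambda>_. B))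
    \<lparr>carrier := {d \<in> module_hom A B B \<inter> extensional (carrier B).
      \<forall>x \<in> carrier B. \<forall>y \<in> carrier B. d (x \<otimes>\<^bsub>B\<^esub> y) = (d x \<otimes>\<^bsub>B\<^esub> y) \<oplus>\<^bsub>B\<^esub> (x \<otimes>\<^bsub>B\<^esub> d y)}\<rparr>"

definition ad :: "('b, 'n) ring_scheme \<Rightarrow> 'b \<Rightarrow> ('b \<Rightarrow> 'b)"
  where "ad B a = (\<lambda>x\<in>carrier B. (a \<otimes>\<^bsub>B\<^esub> x) \<ominus>\<^bsub>B\<^esub> (x \<otimes>\<^bsub>B\<^esub> a))"

definition inner_derivations :: "('a, 'm) ring_scheme \<Rightarrow> ('g, 'n) monoid_scheme \<Rightarrow> (('g \<Rightarrow> 'a) \<Rightarrow> ('g \<Rightarrow> 'a)) set"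
  where "inner_derivations A G =
    {\<Oplus>\<^bsub>D\<^esub>a\<in>F. C a \<odot>\<^bsub>D\<^esub> ad (group_ring A G) (basis_element A G a) | D F C.
      D = Der A (group_ring A G) \<and> finite F \<and> F \<subseteq> carrier G \<and> C \<in> F \<rightarrow> carrier A}"

definition Inn :: "('a, 'm) ring_scheme \<Rightarrow> ('g, 'n) monoid_scheme \<Rightarrow> ('a, ('g \<Rightarrow> 'a) \<Rightarrow> ('g \<Rightarrow> 'a)) module"
  where "Inn A G = (Der A (group_ring A G))\<lparr>carrier := inner_derivations A G\<rparr>"

definition Out :: "('a, 'm) ring_scheme \<Rightarrow> ('g, 'n) monoid_scheme \<Rightarrow> ('a, (('g \<Rightarrow> 'a) \<Rightarrow> ('g \<Rightarrow> 'a)) set) module"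
  where "Out A G = quotient_module (Der A (group_ring A G)) (inner_derivations A G)"

definition conjugacy_classes :: "('g, 'n) monoid_scheme \<Rightarrow> 'g set set"
  where "conjugacy_classes G =
    orbits G (carrier G) (\<lambda>g. \<lambda>h\<in>carrier G. g \<otimes>\<^bsub>G\<^esub> h \<otimes>\<^bsub>G\<^esub> inv\<^bsub>G\<^esub> g)"

definition centralizer :: "('g, 'n) monoid_scheme \<Rightarrow> 'g \<Rightarrow> ('g, 'n) monoid_scheme"
  where "centralizer G u = G\<lparr>carrier := {g \<in> carrier G. g \<otimes>\<^bsub>G\<^esub> u = u \<otimes>\<^bsub>G\<^esub> g}\<rparr>"

definition Hom_Ab :: "('g, 'n) monoid_scheme \<Rightarrow> ('a, 'm) ring_scheme \<Rightarrow> ('a, 'g \<Rightarrow> 'a) module"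
  where "Hom_Ab H A = (product_module (carrier H) (\<lambda>_. regular_module A))
    \<lparr>carrier := hom H (add_monoid A) \<inter> extensional (carrier H)\<rparr>"

end

theory Submission
  imports Defs
begin

text \<open>
  Writing \<open>f g x\<close> for the coefficient of \<open>x\<close> in \<open>d(g) g\<inverse>\<close> turns a derivation
  \<open>d\<close> into a 1-cocycle, \<open>f (g h) x = f g x + f h (g\<inverse> x g)\<close>. For each class representative
  \<open>u\<close> the function \<open>f \<cdot> u\<close> is a homomorphism on \<open>Z(u)\<close>. Fix \<open>t\<^sub>x\<close> conjugating the
  representative of the class of \<open>x\<close> to \<open>x\<close>, and put \<open>y = g\<inverse> x g\<close>. The cocycle identity
  gives \<open>f g x = (f t\<^sub>x x - f t\<^sub>y y) + f (t\<^sub>x\<inverse> g t\<^sub>y) u\<close>, where the first summand is a coboundary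
  and so belongs to an inner derivation, and \<open>t\<^sub>x\<inverse> g t\<^sub>y\<close> lies in \<open>Z(u)\<close>. Conversely every family
  of homomorphisms \<open>\<phi>\<^sub>u\<close> gives a cocycle \<open>\<phi>\<^sub>u (t\<^sub>x\<inverse> g t\<^sub>y)\<close>. Hence restriction to the
  centralizers is a split epimorphism with kernel the inner derivations.
\<close>

subsection \<open>Split epimorphisms of modules\<close>

lemma abelian_group_homI2:
  assumes "abelian_group G" "abelian_group H"
    and "\<And>x. x \<in> carrier G \<Longrightarrow> h x \<in> carrier H"
    and "\<And>x y. x \<in> carrier G \<Longrightarrow> y \<in> carrier G \<Longrightarrow> h (x \<oplus>\<^bsub>G\<^esub> y) = h x \<oplus>\<^bsub>H\<^esub> h y"
  shows "abelian_group_hom G H h"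
  using assms
  by (intro abelian_group_homI) (auto simp: hom_def abelian_group.a_group
    intro!: group_hom.intro group_hom_axioms.intro)

lemma (in abelian_group_hom) hom_finsum:
  assumes "f \<in> I \<rightarrow> carrier G"
  shows "h (\<Oplus>\<^bsub>G\<^esub>i\<in>I. f i) = (\<Oplus>\<^bsub>H\<^esub>i\<in>I. h (f i))"
  using assms
proof (induction I rule: infinite_finite_induct)
  case (insert i I)
  then have "f i \<in> carrier G" "f \<in> I \<rightarrow> carrier G" by auto
  moreover from this have "(\<lambda>i. h (f i)) \<in> I \<rightarrow> carrier H" by (auto intro: hom_closed)
  ultimately show ?case using insert by simp
qed auto

lemma module_homI:
  assumes "\<And>x. x \<in> carrier M \<Longrightarrow> h x \<in> carrier N"
    and "\<And>x y. x \<in> carrier M \<Longrightarrow> y \<in> carrier M \<Longrightarrow> h (x \<oplus>\<^bsub>M\<^esub> y) = h x \<oplus>\<^bsub>N\<^esub> h y"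
    and "\<And>c x. c \<in> carrier R \<Longrightarrow> x \<in> carrier M \<Longrightarrow> h (c \<odot>\<^bsub>M\<^esub> x) = c \<odot>\<^bsub>N\<^esub> h x"
  shows "h \<in> module_hom R M N"
  using assms by (auto simp: module_hom_def)

lemma module_homD:
  assumes "h \<in> module_hom R M N"
  shows "x \<in> carrier M \<Longrightarrow> h x \<in> carrier N"
    and "x \<in> carrier M \<Longrightarrow> y \<in> carrier M \<Longrightarrow> h (x \<oplus>\<^bsub>M\<^esub> y) = h x \<oplus>\<^bsub>N\<^esub> h y"
    and "c \<in> carrier R \<Longrightarrow> x \<in> carrier M \<Longrightarrow> h (c \<odot>\<^bsub>M\<^esub> x) = c \<odot>\<^bsub>N\<^esub> h x"
  using assms by (auto simp: module_hom_def)

text \<open>Every element of \<open>N\<close> has a preimage, so each module axiom in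
  \<open>N\<close> is the image under \<open>h\<close> of the same axiom in \<open>M\<close>. This
  yields the module structure on quotients, binary sums, the group ring and the target of a split
  epimorphism. The condition on zero ties the record field of \<open>N\<close> to the neutral
  element that \<open>h\<close> produces.\<close>

lemma module_surj_image:
  fixes R (structure)
  assumes "module R M" and h: "h \<in> module_hom R M N" and surj: "h ` carrier M = carrier N"
    and zero: "h \<zero>\<^bsub>M\<^esub> = \<zero>\<^bsub>N\<^esub>"
  shows "module R N"
proof -
  interpret M: module R M by fact
  note h = module_homD[OF h]
  have sym_h: "h x \<oplus>\<^bsub>N\<^esub> h y = h (x \<oplus>\<^bsub>M\<^esub> y)" "c \<in> carrier R \<Longrightarrow> c \<odot>\<^bsub>N\<^esub> h x = h (c \<odot>\<^bsub>M\<^esub> x)"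
    if "x \<in> carrier M" "y \<in> carrier M" for x y c
    using that h by auto
  show ?thesis
  proof (rule moduleI)
    show "cring R" by (rule M.is_cring)
    show "abelian_group N"
    proof (rule abelian_groupI, unfold surj[symmetric] zero[symmetric], goal_cases)
      case (6 x)
      then obtain a where "a \<in> carrier M" "x = h a" by auto
      then show ?case
        by (intro bexI[of _ "h (\<ominus>\<^bsub>M\<^esub> a)"]) (auto simp: sym_h M.M.l_neg)
    qed (auto simp: sym_h M.M.a_ac)
  qed (unfold surj[symmetric],
    auto simp: sym_h M.smult_l_distr M.smult_r_distr M.smult_assoc1)
qed

section \<open>Quotients and binary sums of modules\<close>

lemma quotient_module_simps [simp]:
  "carrier (quotient_module M K) = a_rcosets\<^bsub>M\<^esub> K"
  "add (quotient_module M K) = set_add M"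
  "zero (quotient_module M K) = K"
  "smult (quotient_module M K) c X = (\<Union>x\<in>X. K +>\<^bsub>M\<^esub> (c \<odot>\<^bsub>M\<^esub> x))"
  by (simp_all add: quotient_module_def FactRing_def ring.defs)

lemma binary_sum_module_simps [simp]:
  "carrier (binary_sum_module M N) = carrier M \<times> carrier N"
  "add (binary_sum_module M N) (a, b) (c, d) = (a \<oplus>\<^bsub>M\<^esub> c, b \<oplus>\<^bsub>N\<^esub> d)"
  "zero (binary_sum_module M N) = (\<zero>\<^bsub>M\<^esub>, \<zero>\<^bsub>N\<^esub>)"
  "smult (binary_sum_module M N) r (a, b) = (r \<odot>\<^bsub>M\<^esub> a, r \<odot>\<^bsub>N\<^esub> b)"
  by (simp_all add: binary_sum_module_def RDirProd_def ring.defs monoid.defs DirProd_def)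

lemma (in module) submodule_imp_abelian_subgroup:
  "submodule K R M \<Longrightarrow> abelian_subgroup K M"
  using M.abelian_group_axioms
  by (auto intro!: abelian_subgroupI3 additive_subgroup.intro simp: submodule_def)

text \<open>The scalar action on a coset is a union over its members. All members contribute the
  same coset: changing \<open>x\<close> by an element \<open>k\<close> of \<open>K\<close> changes
  the multiple by \<open>c\<close> times \<open>k\<close>, which stays in \<open>K\<close>.\<close>

lemma (in module) coset_hom_quotient_module:
  assumes "submodule K R M"
  shows "(\<lambda>x. K +>\<^bsub>M\<^esub> x) \<in> module_hom R M (quotient_module M K)"
proof -
  interpret K: abelian_subgroup K M
    using assms by (rule submodule_imp_abelian_subgroup)
  interpret S: submodule K R M by fact
  show ?thesis
  proof (rule module_homI)
    fix c x assume cx: "c \<in> carrier R" "x \<in> carrier M"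
    have "K +>\<^bsub>M\<^esub> (c \<odot>\<^bsub>M\<^esub> y) = K +>\<^bsub>M\<^esub> (c \<odot>\<^bsub>M\<^esub> x)" if "y \<in> K +>\<^bsub>M\<^esub> x" for y
    proof -
      from that obtain k where k: "k \<in> K" "y = k \<oplus>\<^bsub>M\<^esub> x"
        by (auto simp: a_r_coset_def')
      then have "c \<odot>\<^bsub>M\<^esub> y = c \<odot>\<^bsub>M\<^esub> k \<oplus>\<^bsub>M\<^esub> c \<odot>\<^bsub>M\<^esub> x"
        using cx by (simp add: smult_r_distr)
      then have "c \<odot>\<^bsub>M\<^esub> y \<in> K +>\<^bsub>M\<^esub> (c \<odot>\<^bsub>M\<^esub> x)"
        using k cx by (auto simp: a_r_coset_def')
      then show ?thesis
        using cx K.a_repr_independence'[of _ "c \<odot>\<^bsub>M\<^esub> x"] by auto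
    qed
    then show "K +>\<^bsub>M\<^esub> (c \<odot>\<^bsub>M\<^esub> x) = c \<odot>\<^bsub>quotient_module M K\<^esub> (K +>\<^bsub>M\<^esub> x)"
      unfolding quotient_module_simps
      by (intro UN_constant_eq[symmetric, OF K.a_rcos_self[OF cx(2)]] ballI)
  next
    fix x y assume "x \<in> carrier M" "y \<in> carrier M"
    then show "K +>\<^bsub>M\<^esub> (x \<oplus>\<^bsub>M\<^esub> y) = (K +>\<^bsub>M\<^esub> x) \<oplus>\<^bsub>quotient_module M K\<^esub> (K +>\<^bsub>M\<^esub> y)"
      by (simp add: K.a_rcos_sum)
  qed (auto simp: A_RCOSETS_def')
qed

lemma (in module) quotient_module_is_module:
  assumes "submodule K R M"
  shows "module R (quotient_module M K)"
proof -
  interpret K: abelian_subgroup K M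
    using assms by (rule submodule_imp_abelian_subgroup)
  show ?thesis
  proof (rule module_surj_image[OF module_axioms coset_hom_quotient_module[OF assms]])
    show "K +>\<^bsub>M\<^esub> \<zero>\<^bsub>M\<^esub> = \<zero>\<^bsub>quotient_module M K\<^esub>"
      by (simp add: K.a_subset)
  qed (auto simp: A_RCOSETS_def')
qed

text \<open>Only \<open>M\<close> is assumed to be a module. That \<open>N\<close> is one follows
  from the surjectivity of \<open>p\<close>, which its right inverse \<open>s\<close> provides,
  together with \<open>p_zero\<close>.\<close>

locale split_epimorphism = module R M for R (structure) and M (structure) +
  fixes N :: "('a, 'd, 'k) module_scheme" and p s
  assumes p: "p \<in> module_hom R M N" and s: "s \<in> module_hom R N M"
    and p_s: "y \<in> carrier N \<Longrightarrow> p (s y) = y"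
    and p_zero: "p \<zero>\<^bsub>M\<^esub> = \<zero>\<^bsub>N\<^esub>"
begin

abbreviation "K \<equiv> {x \<in> carrier M. p x = \<zero>\<^bsub>N\<^esub>}"

lemmas p_simps [simp] = module_homD[OF p]
lemmas s_simps [simp] = module_homD[OF s]

lemma image_p: "p ` carrier M = carrier N"
  proof (intro equalityI subsetI)
    fix y assume "y \<in> carrier N"
    then show "y \<in> p ` carrier M"
      using p_s[of y] s_simps(1)[of y] by (metis imageI)
  qed auto

lemma module_codomain: "module R N"
  by (rule module_surj_image[OF module_axioms p image_p p_zero])

sublocale N: module R N by (rule module_codomain)

sublocale p: abelian_group_hom M N p
  by (rule abelian_group_homI2) (simp_all add: M.abelian_group_axioms N.M.abelian_group_axioms)

sublocale s: abelian_group_hom N M s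
  by (rule abelian_group_homI2) (simp_all add: M.abelian_group_axioms N.M.abelian_group_axioms)

lemma submodule_kernel: "submodule K R M"
  by (rule submoduleI) auto

text \<open>Each \<open>x\<close> splits as the sum of \<open>x \<ominus> s (p x)\<close>, which
  lies in the kernel, and \<open>s (p x)\<close>, which is determined by \<open>p x\<close>. The
  inverse map adds the two parts.\<close>

lemma isomorphic_kernel_sum:
  "module_isomorphic R M (binary_sum_module (M\<lparr>carrier := K\<rparr>) N)"
proof -
  let ?h = "\<lambda>x. (x \<ominus>\<^bsub>M\<^esub> s (p x), p x)"
  let ?S = "binary_sum_module (M\<lparr>carrier := K\<rparr>) N"
  have h: "?h \<in> module_hom R M ?S"
  proof (rule module_homI)
    fix x y assume "x \<in> carrier M" "y \<in> carrier M"
    then show "?h (x \<oplus>\<^bsub>M\<^esub> y) = ?h x \<oplus>\<^bsub>?S\<^esub> ?h y"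
      by (simp add: a_minus_def M.minus_add M.a_ac)
  next
    fix c x assume "c \<in> carrier R" "x \<in> carrier M"
    then show "?h (c \<odot>\<^bsub>M\<^esub> x) = c \<odot>\<^bsub>?S\<^esub> ?h x"
      by (simp add: a_minus_def smult_r_distr smult_r_minus)
  qed (simp add: p_s a_minus_def N.M.r_neg)
  have bij: "bij_betw ?h (carrier M) (carrier ?S)"
  proof (rule bij_betw_byWitness[where f' = "\<lambda>(x, y). x \<oplus>\<^bsub>M\<^esub> s y"])
    show "\<forall>x\<in>carrier M. (case ?h x of (x, y) \<Rightarrow> x \<oplus>\<^bsub>M\<^esub> s y) = x"
      by (simp add: a_minus_def M.a_assoc M.l_neg)
    show "\<forall>z\<in>carrier ?S. ?h (case z of (x, y) \<Rightarrow> x \<oplus>\<^bsub>M\<^esub> s y) = z"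
      by (auto simp: p_s a_minus_def M.a_assoc M.r_neg)
  qed (use module_homD(1)[OF h] in auto)
  \<comment> \<open>\<open>module_isomorphic\<close> also demands that the target be a module;
    surjectivity of \<open>?h\<close> transfers the axioms from \<open>M\<close>.\<close>
  have "?h ` carrier M = carrier ?S"
    using bij by (simp add: bij_betw_def)
  moreover have "?h \<zero>\<^bsub>M\<^esub> = \<zero>\<^bsub>?S\<^esub>"
    using s.hom_zero by (simp add: p_zero a_minus_def)
  ultimately have "module R ?S"
    by (rule module_surj_image[OF module_axioms h])
  with h bij module_axioms show ?thesis
    by (auto simp: module_isomorphic_def)
qed

text \<open>First isomorphism theorem for the surjection \<open>p\<close>: a coset is sent to the
  value of \<open>p\<close> at one of its members picked by \<open>SOME\<close>. The pick is
  harmless because \<open>p\<close> is constant on each coset of its kernel.\<close>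

lemma quotient_kernel_isomorphic:
  "module_isomorphic R (quotient_module M K) N"
proof -
  note K = submodule_imp_abelian_subgroup[OF submodule_kernel]
  let ?Q = "quotient_module M K"
  let ?h = "\<lambda>X. p (SOME x. x \<in> X)"
  have h_coset: "?h (K +>\<^bsub>M\<^esub> x) = p x" if "x \<in> carrier M" for x
  proof -
    have "p y = p x" if "y \<in> K +>\<^bsub>M\<^esub> x" for y
      using that \<open>x \<in> carrier M\<close> by (auto simp: a_r_coset_def')
    then show ?thesis
      using abelian_subgroup.a_rcos_self[OF K that]
      by (rule someI2[where P = "\<lambda>y. y \<in> K +>\<^bsub>M\<^esub> x" and Q = "\<lambda>y. p y = p x", rotated])
  qed
  have carrier_Q: "carrier ?Q = (\<lambda>x. K +>\<^bsub>M\<^esub> x) ` carrier M"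
    by (auto simp: A_RCOSETS_def')
  note coset = module_homD(2,3)[OF coset_hom_quotient_module[OF submodule_kernel], symmetric]
  have h: "?h \<in> module_hom R ?Q N"
  proof (rule module_homI)
    fix X Y assume "X \<in> carrier ?Q" "Y \<in> carrier ?Q"
    then obtain x y where "x \<in> carrier M" "X = K +>\<^bsub>M\<^esub> x" "y \<in> carrier M" "Y = K +>\<^bsub>M\<^esub> y"
      unfolding carrier_Q by blast
    then show "?h (X \<oplus>\<^bsub>?Q\<^esub> Y) = ?h X \<oplus>\<^bsub>N\<^esub> ?h Y"
      using h_coset[of "x \<oplus>\<^bsub>M\<^esub> y"] by (simp only: coset h_coset M.a_closed p_simps)
  next
    fix c X assume "c \<in> carrier R" "X \<in> carrier ?Q"
    then obtain x where "x \<in> carrier M" "X = K +>\<^bsub>M\<^esub> x"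
      unfolding carrier_Q by blast
    with \<open>c \<in> carrier R\<close> show "?h (c \<odot>\<^bsub>?Q\<^esub> X) = c \<odot>\<^bsub>N\<^esub> ?h X"
      using h_coset[of "c \<odot>\<^bsub>M\<^esub> x"] by (simp only: coset h_coset smult_closed p_simps)
  qed (auto simp: carrier_Q h_coset simp del: quotient_module_simps)
  have "bij_betw ?h (carrier ?Q) (carrier N)"
  proof (rule bij_betw_imageI)
    show "inj_on ?h (carrier ?Q)"
    proof (rule inj_onI)
      fix X Y assume "X \<in> carrier ?Q" "Y \<in> carrier ?Q" "?h X = ?h Y"
      then obtain x y where xy: "x \<in> carrier M" "y \<in> carrier M"
        "X = K +>\<^bsub>M\<^esub> x" "Y = K +>\<^bsub>M\<^esub> y"
        unfolding carrier_Q by blast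
      with \<open>?h X = ?h Y\<close> have "p x = p y"
        by (simp add: h_coset)
      with xy have "x \<oplus>\<^bsub>M\<^esub> \<ominus>\<^bsub>M\<^esub> y \<in> K"
        by (simp add: N.M.r_neg)
      then have "x \<in> K +>\<^bsub>M\<^esub> y"
        using xy by (intro abelian_subgroup.a_rcos_module_rev[OF K])
      then show "X = Y"
        using xy abelian_subgroup.a_repr_independence'[OF K, of x y] by auto
    qed
    show "?h ` carrier ?Q = carrier N"
      using image_p by (simp add: carrier_Q image_image h_coset del: quotient_module_simps)
  qed
  with h show ?thesis
    using quotient_module_is_module[OF submodule_kernel] module_codomain
    by (auto simp: module_isomorphic_def)
qed

end

subsection \<open>Products, direct sums and finite sums\<close>

lemma product_module_simps [simp]:
  "carrier (product_module I M) = (\<Pi>\<^sub>E i\<in>I. carrier (M i))"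
  "add (product_module I M) x y = (\<lambda>i\<in>I. x i \<oplus>\<^bsub>M i\<^esub> y i)"
  "zero (product_module I M) = (\<lambda>i\<in>I. \<zero>\<^bsub>M i\<^esub>)"
  "smult (product_module I M) c x = (\<lambda>i\<in>I. c \<odot>\<^bsub>M i\<^esub> x i)"
  by (simp_all add: product_module_def)

lemma product_module_is_module:
  assumes "cring R" and M: "\<And>i. i \<in> I \<Longrightarrow> module R (M i)"
  shows "module R (product_module I M)"
proof (rule moduleI)
  have ag: "abelian_group (M i)" if "i \<in> I" for i
    using M[OF that] by (simp add: module_def)
  have am: "abelian_monoid (M i)" if "i \<in> I" for i
    using ag[OF that] by (simp add: abelian_group_def)
  note [simp] = abelian_monoid.a_closed[OF am] abelian_monoid.zero_closed[OF am]
    abelian_monoid.l_zero[OF am] module.smult_closed[OF M] module.smult_one[OF M]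
    abelian_group.a_inv_closed[OF ag] abelian_group.l_neg[OF ag]
  show "cring R" by fact
  show "abelian_group (product_module I M)"
  proof (rule abelian_groupI, goal_cases)
    case (6 x)
    then have x: "x i \<in> carrier (M i)" if "i \<in> I" for i
      using that by auto
    then show ?case
      by (intro bexI[of _ "\<lambda>i\<in>I. \<ominus>\<^bsub>M i\<^esub> x i"]) (auto simp: fun_eq_iff)
  next
    case (4 x y)
    then show ?case
      by (auto simp: fun_eq_iff PiE_iff abelian_monoid.a_comm[OF am])
  qed (auto simp: fun_eq_iff PiE_iff extensional_def abelian_monoid.a_assoc[OF am])
qed (auto simp: fun_eq_iff PiE_iff extensional_def module.smult_closed[OF M]
    module.smult_l_distr[OF M] module.smult_r_distr[OF M] module.smult_assoc1[OF M]
    module.smult_one[OF M])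

lemma regular_module_simps [simp]:
  "carrier (regular_module R) = carrier R" "add (regular_module R) = add R"
  "zero (regular_module R) = zero R" "smult (regular_module R) = mult R"
  by (simp_all add: regular_module_def)

lemma regular_module_is_module:
  assumes "cring R"
  shows "module R (regular_module R)"
proof -
  interpret cring R by fact
  show ?thesis
  proof (rule moduleI)
    show "abelian_group (regular_module R)"
      by (rule abelian_groupI) (auto simp: a_ac intro: bexI[of _ "\<ominus>\<^bsub>R\<^esub> _"] l_neg)
  qed (auto simp: assms l_distr r_distr m_assoc)
qed

lemma direct_sum_module_simps [simp]:
  "carrier (direct_sum_module I M) =
    {x \<in> \<Pi>\<^sub>E i\<in>I. carrier (M i). finite {i \<in> I. x i \<noteq> \<zero>\<^bsub>M i\<^esub>}}"
  "add (direct_sum_module I M) x y = (\<lambda>i\<in>I. x i \<oplus>\<^bsub>M i\<^esub> y i)"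
  "zero (direct_sum_module I M) = (\<lambda>i\<in>I. \<zero>\<^bsub>M i\<^esub>)"
  "smult (direct_sum_module I M) c x = (\<lambda>i\<in>I. c \<odot>\<^bsub>M i\<^esub> x i)"
  by (simp_all add: direct_sum_module_def)

lemma Hom_Ab_simps [simp]:
  "carrier (Hom_Ab H R) = hom H (add_monoid R) \<inter> extensional (carrier H)"
  "add (Hom_Ab H R) x y = (\<lambda>g\<in>carrier H. x g \<oplus>\<^bsub>R\<^esub> y g)"
  "zero (Hom_Ab H R) = (\<lambda>g\<in>carrier H. \<zero>\<^bsub>R\<^esub>)"
  "smult (Hom_Ab H R) c x = (\<lambda>g\<in>carrier H. c \<otimes>\<^bsub>R\<^esub> x g)"
  by (simp_all add: Hom_Ab_def)

lemma centralizer_simps [simp]: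
  "carrier (centralizer G u) = {g \<in> carrier G. g \<otimes>\<^bsub>G\<^esub> u = u \<otimes>\<^bsub>G\<^esub> g}"
  "mult (centralizer G u) = mult G"
  by (simp_all add: centralizer_def)

lemma basis_element_apply [simp]:
  "h \<in> carrier G \<Longrightarrow> basis_element R G a h = (if h = a then \<one>\<^bsub>R\<^esub> else \<zero>\<^bsub>R\<^esub>)"
  by (simp add: basis_element_def)

section \<open>Rearranging finite sums\<close>

lemma (in abelian_monoid) finsum_swap:
  assumes "finite I" "finite J" "\<And>i j. i \<in> I \<Longrightarrow> j \<in> J \<Longrightarrow> f i j \<in> carrier G"
  shows "(\<Oplus>i\<in>I. \<Oplus>j\<in>J. f i j) = (\<Oplus>j\<in>J. \<Oplus>i\<in>I. f i j)"
  using assms(1,3)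
proof (induction I)
  case (insert a I)
  then have "(\<Oplus>i\<in>insert a I. \<Oplus>j\<in>J. f i j) = (\<Oplus>j\<in>J. f a j) \<oplus> (\<Oplus>j\<in>J. \<Oplus>i\<in>I. f i j)"
    by (subst finsum_insert) (auto intro!: finsum_closed)
  also have "\<dots> = (\<Oplus>j\<in>J. f a j \<oplus> (\<Oplus>i\<in>I. f i j))"
    using insert.prems by (intro finsum_addf[symmetric]) (auto intro!: finsum_closed)
  also have "\<dots> = (\<Oplus>j\<in>J. \<Oplus>i\<in>insert a I. f i j)"
  proof (rule finsum_cong'[OF refl])
    show "(\<lambda>j. \<Oplus>i\<in>insert a I. f i j) \<in> J \<rightarrow> carrier G"
      using insert.prems by (auto intro!: finsum_closed)
    show "f a j \<oplus> (\<Oplus>i\<in>I. f i j) = (\<Oplus>i\<in>insert a I. f i j)" if "j \<in> J" for j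
      using insert that by (subst finsum_insert) auto
  qed
  finally show ?case .
qed simp

lemma (in abelian_monoid) finsum_eq_single:
  assumes "finite I" "i \<in> I" "f i \<in> carrier G" "\<And>j. j \<in> I \<Longrightarrow> j \<noteq> i \<Longrightarrow> f j = \<zero>"
  shows "(\<Oplus>j\<in>I. f j) = f i"
proof -
  have "(\<Oplus>j\<in>I. f j) = f i \<oplus> (\<Oplus>j\<in>I - {i}. f j)"
    using assms by (subst insert_Diff[OF assms(2), symmetric], subst finsum_insert) auto
  also have "(\<Oplus>j\<in>I - {i}. f j) = \<zero>"
    using assms(4) by (auto intro: add.finprod_one_eqI)
  finally show ?thesis using assms(3) by simp
qed

lemma (in abelian_monoid) finsum_reindex_bij:
  assumes "bij_betw h I J" "f \<in> J \<rightarrow> carrier G"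
  shows "(\<Oplus>j\<in>J. f j) = (\<Oplus>i\<in>I. f (h i))"
  using assms finsum_reindex[of f h I] by (auto simp: bij_betw_def)

text \<open>The families of finite support form a submodule of the product: the support of a sum
  lies in the union of the supports, and scaling does not enlarge the support.\<close>

lemma direct_sum_module_is_module:
  assumes "cring R" and M: "\<And>i. i \<in> I \<Longrightarrow> module R (M i)"
  shows "module R (direct_sum_module I M)"
proof -
  interpret P: module R "product_module I M"
    by (rule product_module_is_module[OF assms])
  let ?D = "direct_sum_module I M"
  have sub: "{i \<in> I. (c \<odot>\<^bsub>?D\<^esub> x) i \<noteq> \<zero>\<^bsub>M i\<^esub>} \<subseteq> {i \<in> I. x i \<noteq> \<zero>\<^bsub>M i\<^esub>}"
    if "c \<in> carrier R" for c x
    using that module.smult_r_null[OF M] by auto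
  have add: "{i \<in> I. (x \<oplus>\<^bsub>?D\<^esub> y) i \<noteq> \<zero>\<^bsub>M i\<^esub>}
      \<subseteq> {i \<in> I. x i \<noteq> \<zero>\<^bsub>M i\<^esub>} \<union> {i \<in> I. y i \<noteq> \<zero>\<^bsub>M i\<^esub>}" for x y
    using abelian_monoid.l_zero[OF _ abelian_monoid.zero_closed] M
    by (fastforce simp: module_def abelian_group_def)
  have smult: "c \<odot>\<^bsub>product_module I M\<^esub> x \<in> carrier ?D" if "c \<in> carrier R" "x \<in> carrier ?D" for c x
    using P.smult_closed[of c x] that finite_subset[OF sub[OF that(1), of x]] by simp
  have "submodule (carrier ?D) R (product_module I M)"
  proof (rule P.submoduleI)
    show "a \<oplus>\<^bsub>product_module I M\<^esub> b \<in> carrier ?D" if "a \<in> carrier ?D" "b \<in> carrier ?D" for a b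
      using P.M.a_closed[of a b] that finite_subset[OF add[of a b]] by simp
    show "\<ominus>\<^bsub>product_module I M\<^esub> x \<in> carrier ?D" if x: "x \<in> carrier ?D" for x
    proof -
      \<comment> \<open>Negation is scaling by minus one, so closure under it follows from closure
        under scalars.\<close>
      have "\<ominus>\<^bsub>product_module I M\<^esub> x = (\<ominus>\<^bsub>R\<^esub> \<one>\<^bsub>R\<^esub>) \<odot>\<^bsub>product_module I M\<^esub> x"
        using x P.smult_l_minus[of "\<one>\<^bsub>R\<^esub>" x] P.smult_one[of x] by simp
      with smult[OF _ x] show ?thesis by simp
    qed
  qed (use P.M.zero_closed smult in auto)
  from submodule.submodule_is_module[OF this P.module_axioms] show ?thesis
    by (simp add: direct_sum_module_def)
qed

subsection \<open>The group ring of a finite group and its derivations\<close>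

lemma group_ring_apply [simp]:
  assumes "g \<in> carrier G"
  shows "(x \<oplus>\<^bsub>group_ring R G\<^esub> y) g = x g \<oplus>\<^bsub>R\<^esub> y g"
    and "\<zero>\<^bsub>group_ring R G\<^esub> g = \<zero>\<^bsub>R\<^esub>"
    and "(c \<odot>\<^bsub>group_ring R G\<^esub> x) g = c \<otimes>\<^bsub>R\<^esub> x g"
  using assms by (simp_all add: group_ring_def direct_sum_module_def)

text \<open>The group ring differs from the direct sum only in the fields \<open>mult\<close> and
  \<open>one\<close>, which the module axioms do not mention, so the identity map transfers the
  structure.\<close>

lemma group_ring_is_module:
  assumes "cring R"
  shows "module R (group_ring R G)"
proof (rule module_surj_image)
  let ?D = "direct_sum_module (carrier G) (\<lambda>_. regular_module R)"
  show "module R ?D"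
    by (intro direct_sum_module_is_module regular_module_is_module assms)
  show "(\<lambda>x. x) \<in> module_hom R ?D (group_ring R G)"
    by (auto simp: module_hom_def group_ring_def direct_sum_module_def)
qed (auto simp: group_ring_def)

lemma Der_apply [simp]:
  assumes "x \<in> carrier B"
  shows "(d \<oplus>\<^bsub>Der R B\<^esub> e) x = d x \<oplus>\<^bsub>B\<^esub> e x" "\<zero>\<^bsub>Der R B\<^esub> x = \<zero>\<^bsub>B\<^esub>"
    "(c \<odot>\<^bsub>Der R B\<^esub> d) x = c \<odot>\<^bsub>B\<^esub> d x"
  using assms by (simp_all add: Der_def)

locale finite_group_algebra = G: group G + A: cring A
  for G :: "('g, 'n) monoid_scheme" (structure) and A :: "('a, 'm) ring_scheme" +
  assumes finite_G [simp]: "finite (carrier G)"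
begin

abbreviation "B \<equiv> group_ring A G"
abbreviation "b \<equiv> basis_element A G"
abbreviation "D \<equiv> Der A B"

lemma carrier_B: "carrier B = carrier G \<rightarrow>\<^sub>E carrier A"
  by (simp add: group_ring_def)

sublocale B: module A B
  by (rule group_ring_is_module) (rule A.is_cring)

lemma B_apply [simp]: "x \<in> carrier B \<Longrightarrow> g \<in> carrier G \<Longrightarrow> x g \<in> carrier A"
  by (auto simp: carrier_B)

lemma B_eqI:
  assumes "x \<in> carrier B" "y \<in> carrier B" "\<And>g. g \<in> carrier G \<Longrightarrow> x g = y g"
  shows "x = y"
  using assms by (auto simp: carrier_B intro: PiE_ext)

lemma basis_in_B [simp]: "b g \<in> carrier B"
  by (auto simp: carrier_B basis_element_def)

lemma mult_apply:
  assumes "x \<in> carrier B" "y \<in> carrier B" "k \<in> carrier G"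
  shows "(x \<otimes>\<^bsub>B\<^esub> y) k = (\<Oplus>\<^bsub>A\<^esub>h\<in>carrier G. x h \<otimes>\<^bsub>A\<^esub> y (inv h \<otimes> k))"
proof -
  have "(x \<otimes>\<^bsub>B\<^esub> y) k =
      (\<Oplus>\<^bsub>A\<^esub>h\<in>{h \<in> carrier G. x h \<noteq> \<zero>\<^bsub>A\<^esub>}. x h \<otimes>\<^bsub>A\<^esub> y (inv h \<otimes> k))"
    using assms by (simp add: group_ring_def)
  also have "\<dots> = (\<Oplus>\<^bsub>A\<^esub>h\<in>carrier G. x h \<otimes>\<^bsub>A\<^esub> y (inv h \<otimes> k))"
    \<comment> \<open>Since \<open>G\<close> is finite, the sum may run over the whole group:
      outside the support of \<open>x\<close> the summand has a zero factor.\<close>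
    using assms by (intro A.add.finprod_mono_neutral_cong_left) auto
  finally show ?thesis .
qed

lemma mult_closed [simp]:
  assumes "x \<in> carrier B" "y \<in> carrier B"
  shows "x \<otimes>\<^bsub>B\<^esub> y \<in> carrier B"
proof -
  have "x \<otimes>\<^bsub>B\<^esub> y \<in> extensional (carrier G)"
    by (simp add: group_ring_def)
  moreover have "(x \<otimes>\<^bsub>B\<^esub> y) k \<in> carrier A" if "k \<in> carrier G" for k
    using assms that by (simp add: mult_apply)
  ultimately show ?thesis by (auto simp: carrier_B PiE_iff)
qed

lemma inv_mult_cancel [simp]:
  assumes "x \<in> carrier G" "y \<in> carrier G"
  shows "inv x \<otimes> (x \<otimes> y) = y" "x \<otimes> (inv x \<otimes> y) = y"
    "x \<otimes> y \<otimes> inv y = x" "x \<otimes> inv y \<otimes> y = x"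
  using assms by (simp_all add: G.m_assoc flip: G.m_assoc[of _ x y] G.m_assoc[of _ "inv x" y])

lemma sum_translate:
  assumes "h \<in> carrier G" "f \<in> carrier G \<rightarrow> carrier A"
  shows "(\<Oplus>\<^bsub>A\<^esub>g\<in>carrier G. f g) = (\<Oplus>\<^bsub>A\<^esub>g\<in>carrier G. f (h \<otimes> g))"
proof (rule A.finsum_reindex_bij[OF _ assms(2)])
  show "bij_betw ((\<otimes>) h) (carrier G) (carrier G)"
    by (rule bij_betw_byWitness[where f' = "\<lambda>g. inv h \<otimes> g"]) (use assms(1) in auto)
qed

lemma sum_reflect:
  assumes "k \<in> carrier G" "f \<in> carrier G \<rightarrow> carrier A"
  shows "(\<Oplus>\<^bsub>A\<^esub>g\<in>carrier G. f g) = (\<Oplus>\<^bsub>A\<^esub>g\<in>carrier G. f (k \<otimes> inv g))"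
proof (rule A.finsum_reindex_bij[OF _ assms(2)])
  show "bij_betw (\<lambda>g. k \<otimes> inv g) (carrier G) (carrier G)"
    by (rule bij_betw_byWitness[where f' = "\<lambda>g. inv g \<otimes> k"])
      (use assms(1) in \<open>auto simp: G.inv_mult_group G.m_assoc\<close>)
qed

text \<open>Multiplication by a group element only moves coefficients: in the convolution with
  \<open>b g\<close> the single surviving index is \<open>g\<close>.\<close>

lemma basis_mult:
  assumes "y \<in> carrier B" "g \<in> carrier G" "k \<in> carrier G"
  shows "(b g \<otimes>\<^bsub>B\<^esub> y) k = y (inv g \<otimes> k)"
  unfolding mult_apply[OF basis_in_B assms(1,3)]
  using assms by (subst A.finsum_eq_single[where i = g]) auto

lemma mult_basis:
  assumes "y \<in> carrier B" "g \<in> carrier G" "k \<in> carrier G"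
  shows "(y \<otimes>\<^bsub>B\<^esub> b g) k = y (k \<otimes> inv g)"
proof -
  have eq: "inv h \<otimes> k = g \<longleftrightarrow> h = k \<otimes> inv g" if "h \<in> carrier G" for h
    using assms(2,3) that by (auto simp: G.inv_mult_group G.m_assoc)
  show ?thesis
    unfolding mult_apply[OF assms(1) basis_in_B assms(3)]
    using assms by (subst A.finsum_eq_single[where i = "k \<otimes> inv g"]) (auto simp: eq)
qed

lemma basis_mult_basis:
  assumes "g \<in> carrier G" "h \<in> carrier G"
  shows "b g \<otimes>\<^bsub>B\<^esub> b h = b (g \<otimes> h)"
proof (rule B_eqI)
  fix k assume "k \<in> carrier G"
  then have "inv g \<otimes> k = h \<longleftrightarrow> k = g \<otimes> h"
    using assms by (auto simp: G.inv_mult_group G.m_assoc)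
  with assms \<open>k \<in> carrier G\<close> show "(b g \<otimes>\<^bsub>B\<^esub> b h) k = b (g \<otimes> h) k"
    by (simp add: basis_mult)
qed (use assms in auto)

text \<open>Through \<open>hom_finsum\<close> this evaluates a finite sum in the group ring
  coefficient by coefficient.\<close>

lemma coefficient_hom:
  assumes "k \<in> carrier G"
  shows "abelian_group_hom B A (\<lambda>x. x k)"
  by (rule abelian_group_homI2) (simp_all add: assms B.M.abelian_group_axioms A.abelian_group_axioms)

lemma B_expand:
  assumes "x \<in> carrier B"
  shows "x = (\<Oplus>\<^bsub>B\<^esub>g\<in>carrier G. x g \<odot>\<^bsub>B\<^esub> b g)"
proof (rule B_eqI)
  show sum: "(\<Oplus>\<^bsub>B\<^esub>g\<in>carrier G. x g \<odot>\<^bsub>B\<^esub> b g) \<in> carrier B"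
    using assms by (intro B.M.finsum_closed) auto
  fix k assume k: "k \<in> carrier G"
  have "(\<Oplus>\<^bsub>B\<^esub>g\<in>carrier G. x g \<odot>\<^bsub>B\<^esub> b g) k = (\<Oplus>\<^bsub>A\<^esub>g\<in>carrier G. (x g \<odot>\<^bsub>B\<^esub> b g) k)"
    using assms
    by (intro abelian_group_hom.hom_finsum[OF coefficient_hom[OF k]]) auto
  also have "\<dots> = x k"
    using assms k by (subst A.finsum_eq_single[where i = k]) auto
  finally show "x k = (\<Oplus>\<^bsub>B\<^esub>g\<in>carrier G. x g \<odot>\<^bsub>B\<^esub> b g) k" by simp
qed fact

section \<open>Derivations and their module structure\<close>

lemma carrier_D:
  "carrier D = {d \<in> module_hom A B B \<inter> extensional (carrier B).
    \<forall>x \<in> carrier B. \<forall>y \<in> carrier B. d (x \<otimes>\<^bsub>B\<^esub> y) = (d x \<otimes>\<^bsub>B\<^esub> y) \<oplus>\<^bsub>B\<^esub> (x \<otimes>\<^bsub>B\<^esub> d y)}"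
  by (simp add: Der_def)

text \<open>Reduces linearity and the Leibniz rule to identities in \<open>A\<close>, one for each
  coefficient \<open>k\<close>, where the convolution formulas apply.\<close>

lemma DerI:
  assumes closed: "\<And>x. x \<in> carrier B \<Longrightarrow> d x \<in> carrier B"
    and "d \<in> extensional (carrier B)"
    and add: "\<And>x y k. x \<in> carrier B \<Longrightarrow> y \<in> carrier B \<Longrightarrow> k \<in> carrier G \<Longrightarrow>
      d (x \<oplus>\<^bsub>B\<^esub> y) k = d x k \<oplus>\<^bsub>A\<^esub> d y k"
    and smult: "\<And>c x k. c \<in> carrier A \<Longrightarrow> x \<in> carrier B \<Longrightarrow> k \<in> carrier G \<Longrightarrow>
      d (c \<odot>\<^bsub>B\<^esub> x) k = c \<otimes>\<^bsub>A\<^esub> d x k"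
    and mult: "\<And>x y k. x \<in> carrier B \<Longrightarrow> y \<in> carrier B \<Longrightarrow> k \<in> carrier G \<Longrightarrow>
      d (x \<otimes>\<^bsub>B\<^esub> y) k = (d x \<otimes>\<^bsub>B\<^esub> y) k \<oplus>\<^bsub>A\<^esub> (x \<otimes>\<^bsub>B\<^esub> d y) k"
  shows "d \<in> carrier D"
proof -
  have "d (x \<oplus>\<^bsub>B\<^esub> y) = d x \<oplus>\<^bsub>B\<^esub> d y" if "x \<in> carrier B" "y \<in> carrier B" for x y
    by (rule B_eqI) (simp_all add: that closed add)
  moreover have "d (c \<odot>\<^bsub>B\<^esub> x) = c \<odot>\<^bsub>B\<^esub> d x" if "c \<in> carrier A" "x \<in> carrier B" for c x
    by (rule B_eqI) (simp_all add: that closed smult)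
  moreover have "d (x \<otimes>\<^bsub>B\<^esub> y) = (d x \<otimes>\<^bsub>B\<^esub> y) \<oplus>\<^bsub>B\<^esub> (x \<otimes>\<^bsub>B\<^esub> d y)"
    if "x \<in> carrier B" "y \<in> carrier B" for x y
    by (rule B_eqI) (simp_all add: that closed mult)
  ultimately show ?thesis
    using assms(1,2) by (auto simp: carrier_D intro!: module_homI)
qed

lemma DerD:
  assumes "d \<in> carrier D"
  shows "d \<in> extensional (carrier B)"
    "x \<in> carrier B \<Longrightarrow> d x \<in> carrier B"
    "x \<in> carrier B \<Longrightarrow> y \<in> carrier B \<Longrightarrow> d (x \<oplus>\<^bsub>B\<^esub> y) = d x \<oplus>\<^bsub>B\<^esub> d y"
    "c \<in> carrier A \<Longrightarrow> x \<in> carrier B \<Longrightarrow> d (c \<odot>\<^bsub>B\<^esub> x) = c \<odot>\<^bsub>B\<^esub> d x"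
    "x \<in> carrier B \<Longrightarrow> y \<in> carrier B \<Longrightarrow> d (x \<otimes>\<^bsub>B\<^esub> y) = (d x \<otimes>\<^bsub>B\<^esub> y) \<oplus>\<^bsub>B\<^esub> (x \<otimes>\<^bsub>B\<^esub> d y)"
  using assms by (auto simp: carrier_D dest: module_homD)

text \<open>A derivation is linear and the elements \<open>b g\<close> span the group ring, so its
  values on them determine it.\<close>

lemma Der_eqI:
  assumes d: "d \<in> carrier D" and e: "e \<in> carrier D"
    and eq: "\<And>g k. g \<in> carrier G \<Longrightarrow> k \<in> carrier G \<Longrightarrow> d (b g) k = e (b g) k"
  shows "d = e"
proof (rule extensionalityI[OF DerD(1)[OF d] DerD(1)[OF e]])
  fix x assume x: "x \<in> carrier B"
  have expand: "f x = (\<Oplus>\<^bsub>B\<^esub>g\<in>carrier G. x g \<odot>\<^bsub>B\<^esub> f (b g))" if f: "f \<in> carrier D" for f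
  proof -
    interpret f: abelian_group_hom B B f
      using DerD[OF f] B.M.abelian_group_axioms by (intro abelian_group_homI2)
    have "f x = f (\<Oplus>\<^bsub>B\<^esub>g\<in>carrier G. x g \<odot>\<^bsub>B\<^esub> b g)"
      using B_expand[OF x] by simp
    also have "\<dots> = (\<Oplus>\<^bsub>B\<^esub>g\<in>carrier G. f (x g \<odot>\<^bsub>B\<^esub> b g))"
      using x by (intro f.hom_finsum) auto
    also have "\<dots> = (\<Oplus>\<^bsub>B\<^esub>g\<in>carrier G. x g \<odot>\<^bsub>B\<^esub> f (b g))"
      using x by (intro B.M.finsum_cong') (auto simp: DerD[OF f])
    finally show ?thesis .
  qed
  have "d (b g) = e (b g)" if "g \<in> carrier G" for g
    by (rule B_eqI) (simp_all add: that eq DerD(2)[OF d] DerD(2)[OF e])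
  then show "d x = e x"
    unfolding expand[OF d] expand[OF e] using x
    by (intro B.M.finsum_cong') (auto simp: DerD[OF e])
qed

text \<open>The convolution indexed by the right factor instead of the left. This form suits
  products whose left factor is a derivation applied to an element.\<close>

lemma mult_apply_right:
  assumes "x \<in> carrier B" "y \<in> carrier B" "k \<in> carrier G"
  shows "(x \<otimes>\<^bsub>B\<^esub> y) k = (\<Oplus>\<^bsub>A\<^esub>h\<in>carrier G. x (k \<otimes> inv h) \<otimes>\<^bsub>A\<^esub> y h)"
proof -
  have "(x \<otimes>\<^bsub>B\<^esub> y) k = (\<Oplus>\<^bsub>A\<^esub>h\<in>carrier G. x (k \<otimes> inv h) \<otimes>\<^bsub>A\<^esub> y (inv (k \<otimes> inv h) \<otimes> k))"
    unfolding mult_apply[OF assms]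
    by (rule sum_reflect[where f = "\<lambda>h. x h \<otimes>\<^bsub>A\<^esub> y (inv h \<otimes> k)"]) (use assms in auto)
  also have "\<dots> = (\<Oplus>\<^bsub>A\<^esub>h\<in>carrier G. x (k \<otimes> inv h) \<otimes>\<^bsub>A\<^esub> y h)"
    using assms by (intro A.finsum_cong') (auto simp: G.inv_mult_group G.m_assoc)
  finally show ?thesis .
qed

lemma mult_add_distrib:
  assumes "x \<in> carrier B" "y \<in> carrier B" "z \<in> carrier B" "k \<in> carrier G"
  shows "((x \<oplus>\<^bsub>B\<^esub> y) \<otimes>\<^bsub>B\<^esub> z) k = (x \<otimes>\<^bsub>B\<^esub> z) k \<oplus>\<^bsub>A\<^esub> (y \<otimes>\<^bsub>B\<^esub> z) k"
    and "(z \<otimes>\<^bsub>B\<^esub> (x \<oplus>\<^bsub>B\<^esub> y)) k = (z \<otimes>\<^bsub>B\<^esub> x) k \<oplus>\<^bsub>A\<^esub> (z \<otimes>\<^bsub>B\<^esub> y) k"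
  using assms
  by (auto simp: mult_apply A.l_distr A.r_distr simp flip: A.finsum_addf intro!: A.finsum_cong')

lemma mult_smult:
  assumes "x \<in> carrier B" "y \<in> carrier B" "c \<in> carrier A" "k \<in> carrier G"
  shows "((c \<odot>\<^bsub>B\<^esub> x) \<otimes>\<^bsub>B\<^esub> y) k = c \<otimes>\<^bsub>A\<^esub> (x \<otimes>\<^bsub>B\<^esub> y) k"
    and "(x \<otimes>\<^bsub>B\<^esub> (c \<odot>\<^bsub>B\<^esub> y)) k = c \<otimes>\<^bsub>A\<^esub> (x \<otimes>\<^bsub>B\<^esub> y) k"
  using assms
  by (auto simp: mult_apply A.finsum_rdistr A.m_assoc A.m_lcomm intro!: A.finsum_cong')

lemma mult_zero:
  assumes "x \<in> carrier B" "k \<in> carrier G"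
  shows "(\<zero>\<^bsub>B\<^esub> \<otimes>\<^bsub>B\<^esub> x) k = \<zero>\<^bsub>A\<^esub>" "(x \<otimes>\<^bsub>B\<^esub> \<zero>\<^bsub>B\<^esub>) k = \<zero>\<^bsub>A\<^esub>"
  using assms by (auto simp: mult_apply intro!: A.add.finprod_one_eqI)

text \<open>The derivations form a submodule of the module of all functions from the group ring to
  itself, which is the product of copies of \<open>B\<close> indexed by its own carrier.\<close>

lemma module_Der: "module A D"
proof -
  let ?P = "product_module (carrier B) (\<lambda>_. B)"
  interpret P: module A ?P
    by (intro product_module_is_module A.is_cring B.module_axioms)
  have sub: "carrier D \<subseteq> carrier ?P"
    by (auto simp: carrier_D PiE_iff extensional_def dest: module_homD)
  have smult: "c \<odot>\<^bsub>?P\<^esub> d \<in> carrier D" if c: "c \<in> carrier A" and d: "d \<in> carrier D" for c d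
    by (rule DerI) (simp_all add: c DerD[OF d] A.r_distr A.m_lcomm mult_smult)
  have add: "d \<oplus>\<^bsub>?P\<^esub> e \<in> carrier D" if d: "d \<in> carrier D" and e: "e \<in> carrier D" for d e
    by (rule DerI) (simp_all add: DerD[OF d] DerD[OF e] A.r_distr A.a_ac B.M.a_ac mult_add_distrib)
  have zero: "\<zero>\<^bsub>?P\<^esub> \<in> carrier D"
    by (rule DerI) (simp_all add: mult_zero)
  have "submodule (carrier D) A ?P"
  proof (rule P.submoduleI)
    show "\<ominus>\<^bsub>?P\<^esub> d \<in> carrier D" if d: "d \<in> carrier D" for d
    proof -
      have "\<ominus>\<^bsub>?P\<^esub> d = (\<ominus>\<^bsub>A\<^esub> \<one>\<^bsub>A\<^esub>) \<odot>\<^bsub>?P\<^esub> d"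
        using P.smult_l_minus[of "\<one>\<^bsub>A\<^esub>" d] P.smult_one[of d] subsetD[OF sub d]
        by (simp del: product_module_simps)
      with smult[OF _ d] show ?thesis by (simp del: product_module_simps)
    qed
  qed (use sub smult add zero in \<open>simp_all del: product_module_simps\<close>)
  from submodule.submodule_is_module[OF this P.module_axioms] show ?thesis
    by (simp add: Der_def)
qed

sublocale D: module A D
  by (rule module_Der)

section \<open>Coefficients and cocycles of derivations\<close>

lemma Der_coefficient_hom:
  assumes "x \<in> carrier B" "k \<in> carrier G"
  shows "abelian_group_hom D A (\<lambda>d. d x k)"
  by (rule abelian_group_homI2)
    (simp_all add: assms DerD(2) D.M.abelian_group_axioms A.abelian_group_axioms)

text \<open>These are the 1-cocycles of \<open>G\<close> with values in the functions from
  \<open>G\<close> to \<open>A\<close>, where \<open>g\<close> acts on a function \<open>F\<close>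
  by sending \<open>x\<close> to \<open>F (inv g \<otimes> x \<otimes> g)\<close>.\<close>

definition cocycle :: "('g \<Rightarrow> 'g \<Rightarrow> 'a) \<Rightarrow> bool" where
  "cocycle f \<longleftrightarrow> (\<forall>g\<in>carrier G. \<forall>x\<in>carrier G. f g x \<in> carrier A) \<and>
    (\<forall>g\<in>carrier G. \<forall>h\<in>carrier G. \<forall>x\<in>carrier G.
      f (g \<otimes> h) x = f g x \<oplus>\<^bsub>A\<^esub> f h (inv g \<otimes> x \<otimes> g))"

definition cocycle_of :: "(('g \<Rightarrow> 'a) \<Rightarrow> ('g \<Rightarrow> 'a)) \<Rightarrow> 'g \<Rightarrow> 'g \<Rightarrow> 'a" where
  "cocycle_of d g x = d (b g) (x \<otimes> g)"

text \<open>The linear extension of the rule that gives \<open>b g\<close> the value with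
  coefficient \<open>f g (k \<otimes> inv g)\<close> at \<open>k\<close>. On basis elements it
  inverts \<open>cocycle_of\<close>.\<close>

definition derivation_of :: "('g \<Rightarrow> 'g \<Rightarrow> 'a) \<Rightarrow> ('g \<Rightarrow> 'a) \<Rightarrow> ('g \<Rightarrow> 'a)" where
  "derivation_of f = (\<lambda>x\<in>carrier B. \<lambda>k\<in>carrier G.
    \<Oplus>\<^bsub>A\<^esub>g\<in>carrier G. x g \<otimes>\<^bsub>A\<^esub> f g (k \<otimes> inv g))"

text \<open>Read the Leibniz rule for \<open>b g\<close> times \<open>b h\<close> at the coefficient
  \<open>x \<otimes> g \<otimes> h\<close>. Right multiplication by \<open>h\<close> leaves
  \<open>d (b g)\<close> at \<open>x \<otimes> g\<close>; left multiplication by \<open>g\<close>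
  leaves \<open>d (b h)\<close> at \<open>inv g \<otimes> x \<otimes> g \<otimes> h\<close>.\<close>

lemma cocycle_cocycle_of:
  assumes d: "d \<in> carrier D"
  shows "cocycle (cocycle_of d)"
  unfolding cocycle_def cocycle_of_def
  by (auto simp: DerD[OF d] basis_mult mult_basis G.m_assoc simp flip: basis_mult_basis)

lemma cocycleD:
  assumes "cocycle f"
  shows "g \<in> carrier G \<Longrightarrow> x \<in> carrier G \<Longrightarrow> f g x \<in> carrier A"
    and "g \<in> carrier G \<Longrightarrow> h \<in> carrier G \<Longrightarrow> x \<in> carrier G \<Longrightarrow>
      f (g \<otimes> h) x = f g x \<oplus>\<^bsub>A\<^esub> f h (inv g \<otimes> x \<otimes> g)"
  using assms by (auto simp: cocycle_def)

lemma derivation_of_apply: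
  assumes "x \<in> carrier B" "k \<in> carrier G"
  shows "derivation_of f x k = (\<Oplus>\<^bsub>A\<^esub>g\<in>carrier G. x g \<otimes>\<^bsub>A\<^esub> f g (k \<otimes> inv g))"
  using assms by (simp add: derivation_of_def)

lemma derivation_of_basis:
  assumes f: "cocycle f" and "g \<in> carrier G" "k \<in> carrier G"
  shows "derivation_of f (b g) k = f g (k \<otimes> inv g)"
  unfolding derivation_of_apply[OF basis_in_B assms(3)]
  using assms by (subst A.finsum_eq_single[where i = g]) (auto simp: cocycleD[OF f])

text \<open>Only the Leibniz rule uses the cocycle identity: the value on a product is a double sum
  over pairs of group elements, and the identity splits each summand into one part for each
  factor.\<close>

lemma derivation_of_in_Der:
  assumes f: "cocycle f"
  shows "derivation_of f \<in> carrier D"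
proof (rule DerI)
  note f = cocycleD[OF f]
  show closed: "derivation_of f x \<in> carrier B" if x: "x \<in> carrier B" for x
    using x unfolding carrier_B
    by (auto simp: derivation_of_def carrier_B f intro!: A.finsum_closed)
  show "derivation_of f \<in> extensional (carrier B)"
    by (simp add: derivation_of_def)
  show "derivation_of f (x \<oplus>\<^bsub>B\<^esub> y) k = derivation_of f x k \<oplus>\<^bsub>A\<^esub> derivation_of f y k"
    if "x \<in> carrier B" "y \<in> carrier B" "k \<in> carrier G" for x y k
    using that
    by (auto simp: derivation_of_apply f A.l_distr simp flip: A.finsum_addf intro!: A.finsum_cong')
  show "derivation_of f (c \<odot>\<^bsub>B\<^esub> x) k = c \<otimes>\<^bsub>A\<^esub> derivation_of f x k"
    if "c \<in> carrier A" "x \<in> carrier B" "k \<in> carrier G" for c x k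
    using that
    by (auto simp: derivation_of_apply f A.finsum_rdistr A.m_assoc intro!: A.finsum_cong')
  show "derivation_of f (x \<otimes>\<^bsub>B\<^esub> y) k =
      (derivation_of f x \<otimes>\<^bsub>B\<^esub> y) k \<oplus>\<^bsub>A\<^esub> (x \<otimes>\<^bsub>B\<^esub> derivation_of f y) k"
    if x: "x \<in> carrier B" and y: "y \<in> carrier B" and k: "k \<in> carrier G" for x y k
  proof -
    let ?S = "\<lambda>u. \<Oplus>\<^bsub>A\<^esub>g\<in>carrier G. u g"
    \<comment> \<open>A pair \<open>(h, m)\<close> contributes at \<open>g = h \<otimes> m\<close>,
      and the cocycle identity splits \<open>f (h \<otimes> m)\<close> into an
      \<open>h\<close>-term, giving \<open>?L\<close>, and an \<open>m\<close>-term, giving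
      \<open>?R\<close>.\<close>
    let ?L = "\<lambda>h m. (x h \<otimes>\<^bsub>A\<^esub> y m) \<otimes>\<^bsub>A\<^esub> f h (k \<otimes> inv m \<otimes> inv h)"
    let ?R = "\<lambda>h m. (x h \<otimes>\<^bsub>A\<^esub> y m) \<otimes>\<^bsub>A\<^esub> f m (inv h \<otimes> k \<otimes> inv m)"
    note [simp] = x y k f B_apply[OF x] B_apply[OF y]
    have "derivation_of f (x \<otimes>\<^bsub>B\<^esub> y) k =
        ?S (\<lambda>g. ?S (\<lambda>h. (x h \<otimes>\<^bsub>A\<^esub> y (inv h \<otimes> g)) \<otimes>\<^bsub>A\<^esub> f g (k \<otimes> inv g)))"
      by (auto simp: derivation_of_apply mult_apply A.finsum_ldistr intro!: A.finsum_cong' A.finsum_closed)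
    also have "\<dots> = ?S (\<lambda>h. ?S (\<lambda>g. (x h \<otimes>\<^bsub>A\<^esub> y (inv h \<otimes> g)) \<otimes>\<^bsub>A\<^esub> f g (k \<otimes> inv g)))"
      by (rule A.finsum_swap) auto
    also have "\<dots> = ?S (\<lambda>h. ?S (\<lambda>m. ?L h m \<oplus>\<^bsub>A\<^esub> ?R h m))"
    proof (rule A.finsum_cong'[OF refl])
      fix h assume h: "h \<in> carrier G"
      \<comment> \<open>For fixed \<open>h\<close> substitute \<open>g = h \<otimes> m\<close>, so
        that \<open>y\<close> is evaluated at \<open>m\<close>.\<close>
      have "?S (\<lambda>g. (x h \<otimes>\<^bsub>A\<^esub> y (inv h \<otimes> g)) \<otimes>\<^bsub>A\<^esub> f g (k \<otimes> inv g)) =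
          ?S (\<lambda>m. (x h \<otimes>\<^bsub>A\<^esub> y (inv h \<otimes> (h \<otimes> m))) \<otimes>\<^bsub>A\<^esub> f (h \<otimes> m) (k \<otimes> inv (h \<otimes> m)))"
        by (rule sum_translate[OF h, where
          f = "\<lambda>g. (x h \<otimes>\<^bsub>A\<^esub> y (inv h \<otimes> g)) \<otimes>\<^bsub>A\<^esub> f g (k \<otimes> inv g)"]) (auto simp: h)
      also have "\<dots> = ?S (\<lambda>m. ?L h m \<oplus>\<^bsub>A\<^esub> ?R h m)"
        using h by (intro A.finsum_cong') (auto simp: G.inv_mult_group G.m_assoc A.r_distr)
      finally show "?S (\<lambda>g. (x h \<otimes>\<^bsub>A\<^esub> y (inv h \<otimes> g)) \<otimes>\<^bsub>A\<^esub> f g (k \<otimes> inv g)) =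
        ?S (\<lambda>m. ?L h m \<oplus>\<^bsub>A\<^esub> ?R h m)" .
    qed (auto intro!: A.finsum_closed)
    also have "\<dots> = ?S (\<lambda>h. ?S (?L h)) \<oplus>\<^bsub>A\<^esub> ?S (\<lambda>h. ?S (?R h))"
      by (auto simp flip: A.finsum_addf intro!: A.finsum_cong' A.finsum_closed)
    \<comment> \<open>With \<open>m\<close> outside, the inner sum over \<open>h\<close> is the
      coefficient of \<open>derivation_of f x\<close> at \<open>k \<otimes> inv m\<close>, as the
      right-indexed convolution requires.\<close>
    also have "?S (\<lambda>h. ?S (?L h)) = ?S (\<lambda>m. ?S (\<lambda>h. ?L h m))"
      by (rule A.finsum_swap) auto
    also have "\<dots> = (derivation_of f x \<otimes>\<^bsub>B\<^esub> y) k"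
    proof -
      have "?S (\<lambda>h. ?L h m) = derivation_of f x (k \<otimes> inv m) \<otimes>\<^bsub>A\<^esub> y m" if "m \<in> carrier G" for m
      proof -
        have "?L h m = (x h \<otimes>\<^bsub>A\<^esub> f h (k \<otimes> inv m \<otimes> inv h)) \<otimes>\<^bsub>A\<^esub> y m" if "h \<in> carrier G" for h
          using that \<open>m \<in> carrier G\<close> by (simp add: A.m_ac)
        then have "?S (\<lambda>h. ?L h m) =
            ?S (\<lambda>h. (x h \<otimes>\<^bsub>A\<^esub> f h (k \<otimes> inv m \<otimes> inv h)) \<otimes>\<^bsub>A\<^esub> y m)"
          using that by (intro A.finsum_cong') auto
        also have "\<dots> = derivation_of f x (k \<otimes> inv m) \<otimes>\<^bsub>A\<^esub> y m"
          using that by (subst A.finsum_ldistr[symmetric]) (auto simp: derivation_of_apply)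
        finally show ?thesis .
      qed
      then show ?thesis
        unfolding mult_apply_right[OF closed[OF x] y k] using closed[OF x]
        by (intro A.finsum_cong') auto
    qed
    \<comment> \<open>Here the inner sum over \<open>m\<close> is already the coefficient of
      \<open>derivation_of f y\<close> at \<open>inv h \<otimes> k\<close>, so no exchange of sums
      is needed.\<close>
    also have "?S (\<lambda>h. ?S (?R h)) = (x \<otimes>\<^bsub>B\<^esub> derivation_of f y) k"
      using closed
      by (auto simp: mult_apply derivation_of_apply A.finsum_rdistr A.m_ac
        intro!: A.finsum_cong' A.finsum_closed)
    finally show ?thesis .
  qed
qed

section \<open>Inner derivations as coboundaries\<close>

lemma ad_basis:
  assumes a: "a \<in> carrier G"
  shows "ad B (b a) \<in> carrier D"
    and "x \<in> carrier B \<Longrightarrow> k \<in> carrier G \<Longrightarrow>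
      ad B (b a) x k = x (inv a \<otimes> k) \<ominus>\<^bsub>A\<^esub> x (k \<otimes> inv a)"
proof -
  show ad_apply: "ad B (b a) x k = x (inv a \<otimes> k) \<ominus>\<^bsub>A\<^esub> x (k \<otimes> inv a)"
    if "x \<in> carrier B" "k \<in> carrier G" for x k
  proof -
    interpret k: abelian_group_hom B A "\<lambda>x. x k"
      using that(2) by (rule coefficient_hom)
    show ?thesis
      using that a by (simp add: ad_def a_minus_def basis_mult mult_basis k.hom_a_inv)
  qed
  \<comment> \<open>The coboundary of the indicator function of \<open>a\<close>: its value at
    \<open>x\<close> minus its value at \<open>inv g \<otimes> x \<otimes> g\<close>. Identifying
    \<open>ad B (b a)\<close> with the derivation of this cocycle shows that it lies in
    \<open>D\<close>.\<close>
  let ?f = "\<lambda>g x. (if x = a then \<one>\<^bsub>A\<^esub> else \<zero>\<^bsub>A\<^esub>) \<oplus>\<^bsub>A\<^esub>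
    (if inv g \<otimes> x \<otimes> g = a then \<ominus>\<^bsub>A\<^esub> \<one>\<^bsub>A\<^esub> else \<zero>\<^bsub>A\<^esub>)"
  have f: "cocycle ?f"
    by (auto simp: cocycle_def G.m_assoc G.inv_mult_group A.a_assoc A.l_neg A.r_neg A.a_comm A.a_lcomm)
  have "ad B (b a) = derivation_of ?f"
  proof (rule extensionalityI)
    fix x assume x: "x \<in> carrier B"
    show "ad B (b a) x = derivation_of ?f x"
    proof (rule B_eqI)
      fix k assume k: "k \<in> carrier G"
      \<comment> \<open>For fixed \<open>k\<close> each indicator singles out one group element, so
        both halves of the sum collapse to a single coefficient of \<open>x\<close>.\<close>
      have 1: "k \<otimes> inv g = a \<longleftrightarrow> g = inv a \<otimes> k" if "g \<in> carrier G" for g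
        using a k that by (auto simp: G.inv_mult_group G.m_assoc)
      have 2: "inv g \<otimes> k = a \<longleftrightarrow> g = k \<otimes> inv a" if "g \<in> carrier G" for g
        using a k that by (auto simp: G.inv_mult_group G.m_assoc)
      have "derivation_of ?f x k =
        (\<Oplus>\<^bsub>A\<^esub>g\<in>carrier G. (if g = inv a \<otimes> k then x g else \<zero>\<^bsub>A\<^esub>) \<oplus>\<^bsub>A\<^esub>
          (if g = k \<otimes> inv a then \<ominus>\<^bsub>A\<^esub> x g else \<zero>\<^bsub>A\<^esub>))"
        unfolding derivation_of_apply[OF x k] using x k a
        by (intro A.finsum_cong') (auto simp: 1 2 G.m_assoc A.r_distr A.r_minus)
      also have "\<dots> = (\<Oplus>\<^bsub>A\<^esub>g\<in>carrier G. if g = inv a \<otimes> k then x g else \<zero>\<^bsub>A\<^esub>) \<oplus>\<^bsub>A\<^esub>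
          (\<Oplus>\<^bsub>A\<^esub>g\<in>carrier G. if g = k \<otimes> inv a then \<ominus>\<^bsub>A\<^esub> x g else \<zero>\<^bsub>A\<^esub>)"
        using x k by (intro A.finsum_addf) auto
      also have "(\<Oplus>\<^bsub>A\<^esub>g\<in>carrier G. if g = inv a \<otimes> k then x g else \<zero>\<^bsub>A\<^esub>) = x (inv a \<otimes> k)"
        using x k a by (subst A.finsum_eq_single[where i = "inv a \<otimes> k"]) auto
      also have "(\<Oplus>\<^bsub>A\<^esub>g\<in>carrier G. if g = k \<otimes> inv a then \<ominus>\<^bsub>A\<^esub> x g else \<zero>\<^bsub>A\<^esub>) = \<ominus>\<^bsub>A\<^esub> x (k \<otimes> inv a)"
        using x k a by (subst A.finsum_eq_single[where i = "k \<otimes> inv a"]) auto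
      finally show "ad B (b a) x k = derivation_of ?f x k"
        using x k by (simp add: ad_apply a_minus_def)
    qed (use x DerD(2)[OF derivation_of_in_Der[OF f]] in
        \<open>simp_all add: ad_def B.M.minus_closed\<close>)
  qed (simp_all add: ad_def derivation_of_def)
  then show "ad B (b a) \<in> carrier D"
    using derivation_of_in_Der[OF f] by simp
qed

end

subsection \<open>Restriction of cocycles to centralizers\<close>

context finite_group_algebra
begin

definition conjugacy_class :: "'g \<Rightarrow> 'g set" where
  "conjugacy_class x = (\<lambda>g. g \<otimes> x \<otimes> inv g) ` carrier G"

lemma conjugacy_classes_eq: "conjugacy_classes G = conjugacy_class ` carrier G"
  by (auto simp: conjugacy_classes_def orbits_def orbit_def conjugacy_class_def image_def)

text \<open>Conjugating \<open>g \<otimes> x \<otimes> inv g\<close> by \<open>h\<close> is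
  conjugating \<open>x\<close> by \<open>h \<otimes> g\<close>, and conjugating \<open>x\<close> by
  \<open>h\<close> is conjugating \<open>g \<otimes> x \<otimes> inv g\<close> by
  \<open>h \<otimes> inv g\<close>.\<close>

lemma conjugacy_class_conjugate:
  assumes "g \<in> carrier G" "x \<in> carrier G"
  shows "conjugacy_class (g \<otimes> x \<otimes> inv g) = conjugacy_class x"
proof (intro equalityI subsetI)
  fix y assume "y \<in> conjugacy_class (g \<otimes> x \<otimes> inv g)"
  then obtain h where "h \<in> carrier G" "y = (h \<otimes> g) \<otimes> x \<otimes> inv (h \<otimes> g)"
    using assms by (auto simp: conjugacy_class_def G.inv_mult_group G.m_assoc)
  then show "y \<in> conjugacy_class x"
    unfolding conjugacy_class_def using assms(1) by (intro image_eqI[of _ _ "h \<otimes> g"]) auto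
next
  fix y assume "y \<in> conjugacy_class x"
  then obtain h where "h \<in> carrier G" "y = h \<otimes> x \<otimes> inv h"
    by (auto simp: conjugacy_class_def)
  then have "h \<otimes> inv g \<in> carrier G"
    "y = (h \<otimes> inv g) \<otimes> (g \<otimes> x \<otimes> inv g) \<otimes> inv (h \<otimes> inv g)"
    using assms by (simp_all add: G.inv_mult_group G.m_assoc)
  then show "y \<in> conjugacy_class (g \<otimes> x \<otimes> inv g)"
    unfolding conjugacy_class_def by (intro image_eqI[of _ _ "h \<otimes> inv g"])
qed

lemma conjugacy_class_conjugate_inv:
  assumes "g \<in> carrier G" "x \<in> carrier G"
  shows "conjugacy_class (inv g \<otimes> x \<otimes> g) = conjugacy_class x"
  using conjugacy_class_conjugate[of "inv g" x] assms by simp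

end

section \<open>Class representatives and transport into centralizers\<close>

locale conjugacy_representatives = finite_group_algebra G A
  for G :: "('g, 'n) monoid_scheme" (structure) and A :: "('a, 'm) ring_scheme" +
  fixes rep :: "'g set \<Rightarrow> 'g"
  assumes rep: "K \<in> conjugacy_classes G \<Longrightarrow> rep K \<in> K"
begin

abbreviation "Z K \<equiv> centralizer G (rep K)"
abbreviation "N \<equiv> direct_sum_module (conjugacy_classes G) (\<lambda>K. Hom_Ab (Z K) A)"

lemma rep_class:
  assumes "K \<in> conjugacy_classes G"
  shows "rep K \<in> carrier G" "conjugacy_class (rep K) = K"
proof -
  obtain x where x: "x \<in> carrier G" "K = conjugacy_class x"
    using assms by (auto simp: conjugacy_classes_eq)
  then obtain g where "g \<in> carrier G" "rep K = g \<otimes> x \<otimes> inv g"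
    using rep[OF assms] by (auto simp: conjugacy_class_def)
  with x show "rep K \<in> carrier G" "conjugacy_class (rep K) = K"
    by (auto simp: conjugacy_class_conjugate)
qed

lemma conjugacy_class_in_classes [simp]:
  "x \<in> carrier G \<Longrightarrow> conjugacy_class x \<in> conjugacy_classes G"
  by (simp add: conjugacy_classes_eq)

text \<open>An element that conjugates the representative of the class of \<open>x\<close> to
  \<open>x\<close>, with the equation written free of inverses. The section \<open>extension\<close>
  built below depends on this choice.\<close>

definition conjugator :: "'g \<Rightarrow> 'g" where
  "conjugator x = (SOME t. t \<in> carrier G \<and> t \<otimes> rep (conjugacy_class x) = x \<otimes> t)"

lemma conjugator:
  assumes x: "x \<in> carrier G"
  shows "conjugator x \<in> carrier G"
    "conjugator x \<otimes> rep (conjugacy_class x) = x \<otimes> conjugator x"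
proof -
  have "\<exists>t. t \<in> carrier G \<and> t \<otimes> rep (conjugacy_class x) = x \<otimes> t"
  proof -
    have "rep (conjugacy_class x) \<in> conjugacy_class x"
      using x by (intro rep) simp
    then obtain g where "g \<in> carrier G" "rep (conjugacy_class x) = g \<otimes> x \<otimes> inv g"
      unfolding conjugacy_class_def by blast
    with x show ?thesis
      \<comment> \<open>The representative is \<open>g \<otimes> x \<otimes> inv g\<close>, so the
        way back to \<open>x\<close> is conjugation by \<open>inv g\<close>.\<close>
      by (intro exI[of _ "inv g"]) (simp add: G.m_assoc)
  qed
  then show "conjugator x \<in> carrier G"
    "conjugator x \<otimes> rep (conjugacy_class x) = x \<otimes> conjugator x"
    unfolding conjugator_def by (metis (mono_tags, lifting) someI_ex)+
qed

text \<open>In the groupoid of the conjugation action, \<open>g\<close> is an arrow from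
  \<open>inv g \<otimes> x \<otimes> g\<close> to \<open>x\<close>. The chosen conjugators turn it
  into a loop at the class representative.\<close>

definition transport :: "'g \<Rightarrow> 'g \<Rightarrow> 'g" where
  "transport g x = inv (conjugator x) \<otimes> g \<otimes> conjugator (inv g \<otimes> x \<otimes> g)"

text \<open>Conjugation by \<open>s\<close> takes \<open>u\<close> to \<open>y\<close>, by
  \<open>g\<close> takes \<open>y\<close> to \<open>x\<close>, and by \<open>inv t\<close> takes
  \<open>x\<close> back to \<open>u\<close>; the composite therefore fixes \<open>u\<close>.\<close>

lemma transport_in_centralizer:
  assumes g: "g \<in> carrier G" and x: "x \<in> carrier G"
  shows "transport g x \<in> carrier (Z (conjugacy_class x))"
proof -
  define y u s t where "y = inv g \<otimes> x \<otimes> g" and "u = rep (conjugacy_class x)"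
    and "s = conjugator y" and "t = conjugator x"
  have [simp]: "y \<in> carrier G" "u \<in> carrier G" "s \<in> carrier G" "t \<in> carrier G"
    using g x by (simp_all add: y_def u_def s_def t_def rep_class conjugator)
  have cy: "conjugacy_class y = conjugacy_class x"
    unfolding y_def using g x by (rule conjugacy_class_conjugate_inv)
  have su: "s \<otimes> u = y \<otimes> s"
    using conjugator(2)[of y] by (simp add: s_def u_def cy)
  have tu: "t \<otimes> u = x \<otimes> t"
    using conjugator(2)[OF x] by (simp add: t_def u_def)
  have tx: "inv t \<otimes> x = u \<otimes> inv t"
  proof -
    have "inv t \<otimes> x = inv t \<otimes> (x \<otimes> t) \<otimes> inv t"
      using x by (simp add: G.m_assoc)
    also have "\<dots> = u \<otimes> inv t"
      by (simp flip: tu)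
    finally show ?thesis .
  qed
  have "inv t \<otimes> g \<otimes> s \<otimes> u = inv t \<otimes> g \<otimes> (y \<otimes> s)"
    using g by (simp add: G.m_assoc su)
  also have "\<dots> = (inv t \<otimes> x) \<otimes> g \<otimes> s"
    using g x by (simp add: G.m_assoc y_def)
  also have "\<dots> = u \<otimes> (inv t \<otimes> g \<otimes> s)"
    using g by (simp add: G.m_assoc tx)
  finally show ?thesis
    using g by (simp add: transport_def flip: y_def s_def t_def u_def)
qed

text \<open>Functoriality of the passage from arrows to loops: the conjugator of the intermediate
  point \<open>inv g \<otimes> x \<otimes> g\<close> cancels against its inverse.\<close>

lemma transport_mult:
  assumes "g \<in> carrier G" "h \<in> carrier G" "x \<in> carrier G"
  shows "transport (g \<otimes> h) x = transport g x \<otimes> transport h (inv g \<otimes> x \<otimes> g)"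
  using assms conjugator(1)
  by (simp add: transport_def G.m_assoc G.inv_mult_group)

section \<open>Restriction to centralizers and extension from them\<close>

definition restriction :: "(('g \<Rightarrow> 'a) \<Rightarrow> ('g \<Rightarrow> 'a)) \<Rightarrow> 'g set \<Rightarrow> 'g \<Rightarrow> 'a" where
  "restriction d = (\<lambda>K\<in>conjugacy_classes G. \<lambda>z\<in>carrier (Z K). cocycle_of d z (rep K))"

definition extension :: "('g set \<Rightarrow> 'g \<Rightarrow> 'a) \<Rightarrow> ('g \<Rightarrow> 'a) \<Rightarrow> ('g \<Rightarrow> 'a)" where
  "extension \<phi> = derivation_of (\<lambda>g x. \<phi> (conjugacy_class x) (transport g x))"

lemma carrier_N: "carrier N = (\<Pi>\<^sub>E K\<in>conjugacy_classes G. hom (Z K) (add_monoid A) \<inter> extensional (carrier (Z K)))"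
  by (simp add: conjugacy_classes_eq)

lemma N_D:
  assumes "\<phi> \<in> carrier N" "K \<in> conjugacy_classes G"
  shows "z \<in> carrier (Z K) \<Longrightarrow> \<phi> K z \<in> carrier A"
    and "z \<in> carrier (Z K) \<Longrightarrow> w \<in> carrier (Z K) \<Longrightarrow> \<phi> K (z \<otimes> w) = \<phi> K z \<oplus>\<^bsub>A\<^esub> \<phi> K w"
proof -
  have "\<phi> K \<in> hom (Z K) (add_monoid A)"
    using assms by (auto simp: carrier_N)
  then show "z \<in> carrier (Z K) \<Longrightarrow> \<phi> K z \<in> carrier A"
    and "z \<in> carrier (Z K) \<Longrightarrow> w \<in> carrier (Z K) \<Longrightarrow> \<phi> K (z \<otimes> w) = \<phi> K z \<oplus>\<^bsub>A\<^esub> \<phi> K w"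
    unfolding hom_def by auto
qed

text \<open>Since \<open>x\<close> and \<open>inv g \<otimes> x \<otimes> g\<close> share their
  class, both summands of the cocycle identity involve the same homomorphism, and the identity
  becomes its additivity on the product in \<open>transport_mult\<close>.\<close>

lemma cocycle_extension:
  assumes \<phi>: "\<phi> \<in> carrier N"
  shows "cocycle (\<lambda>g x. \<phi> (conjugacy_class x) (transport g x))"
  unfolding cocycle_def
proof (intro conjI ballI)
  fix g h x assume *: "g \<in> carrier G" "h \<in> carrier G" "x \<in> carrier G"
  let ?y = "inv g \<otimes> x \<otimes> g"
  have "conjugacy_class ?y = conjugacy_class x"
    using * by (simp add: conjugacy_class_conjugate_inv)
  with * show "\<phi> (conjugacy_class x) (transport (g \<otimes> h) x) =
      \<phi> (conjugacy_class x) (transport g x) \<oplus>\<^bsub>A\<^esub> \<phi> (conjugacy_class ?y) (transport h ?y)"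
    using transport_in_centralizer[of h ?y] transport_in_centralizer[of g x]
    by (simp add: transport_mult N_D(2)[OF \<phi>] del: centralizer_simps)
qed (use N_D(1)[OF \<phi>] transport_in_centralizer in auto)

lemma extension_basis:
  assumes "\<phi> \<in> carrier N" "g \<in> carrier G" "k \<in> carrier G"
  shows "extension \<phi> (b g) k = \<phi> (conjugacy_class (k \<otimes> inv g)) (transport g (k \<otimes> inv g))"
  unfolding extension_def using cocycle_extension[OF assms(1)] assms(2,3)
  by (rule derivation_of_basis)

lemma restriction_apply:
  assumes "K \<in> conjugacy_classes G" "z \<in> carrier (Z K)"
  shows "restriction d K z = cocycle_of d z (rep K)"
  using assms by (simp add: restriction_def)

lemma centralizer_mult_closed:
  assumes "K \<in> conjugacy_classes G" "z \<in> carrier (Z K)" "w \<in> carrier (Z K)"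
  shows "z \<otimes> w \<in> carrier (Z K)"
proof -
  have *: "z \<in> carrier G" "w \<in> carrier G" "rep K \<in> carrier G"
    "z \<otimes> rep K = rep K \<otimes> z" "w \<otimes> rep K = rep K \<otimes> w"
    using assms rep_class(1) by simp_all
  have "z \<otimes> w \<otimes> rep K = z \<otimes> (w \<otimes> rep K)"
    using *(1-3) by (simp add: G.m_assoc)
  also have "\<dots> = (z \<otimes> rep K) \<otimes> w"
    unfolding *(5) using *(1-3) by (simp add: G.m_assoc)
  also have "\<dots> = rep K \<otimes> (z \<otimes> w)"
    unfolding *(4) using *(1-3) by (simp add: G.m_assoc)
  finally show ?thesis
    using * by simp
qed

text \<open>Conjugation by an element of the centralizer fixes \<open>rep K\<close>, so the twist in
  the cocycle identity disappears and plain additivity remains.\<close>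

lemma restriction_mult:
  assumes d: "d \<in> carrier D" and K: "K \<in> conjugacy_classes G"
    and z: "z \<in> carrier (Z K)" and w: "w \<in> carrier (Z K)"
  shows "restriction d K (z \<otimes> w) = restriction d K z \<oplus>\<^bsub>A\<^esub> restriction d K w"
proof -
  have *: "z \<in> carrier G" "rep K \<in> carrier G" "z \<otimes> rep K = rep K \<otimes> z"
    using z rep_class(1)[OF K] by simp_all
  then have "inv z \<otimes> rep K \<otimes> z = rep K"
    by (simp add: G.m_assoc flip: *(3))
  then have "cocycle_of d (z \<otimes> w) (rep K) = cocycle_of d z (rep K) \<oplus>\<^bsub>A\<^esub> cocycle_of d w (rep K)"
    using z w rep_class(1)[OF K] cocycleD(2)[OF cocycle_cocycle_of[OF d], of z w "rep K"] by simp
  with K z w show ?thesis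
    by (simp only: restriction_apply centralizer_mult_closed)
qed

lemma restriction_closed:
  assumes d: "d \<in> carrier D"
  shows "restriction d \<in> carrier N"
  unfolding carrier_N
proof (rule PiE_I)
  fix K assume K: "K \<in> conjugacy_classes G"
  have "restriction d K z \<in> carrier A" if "z \<in> carrier (Z K)" for z
    using that rep_class(1)[OF K] cocycleD(1)[OF cocycle_cocycle_of[OF d]]
    by (simp add: restriction_apply[OF K that])
  with d K have "restriction d K \<in> hom (Z K) (add_monoid A)"
    by (auto simp: hom_def restriction_mult simp del: centralizer_simps(1))
  moreover have "restriction d K \<in> extensional (carrier (Z K))"
    using K by (simp add: restriction_def del: centralizer_simps)
  ultimately show "restriction d K \<in> hom (Z K) (add_monoid A) \<inter> extensional (carrier (Z K))" ..
qed (simp add: restriction_def)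

lemma restriction_hom: "restriction \<in> module_hom A D N"
  by (rule module_homI)
    (simp add: restriction_closed del: direct_sum_module_simps(1),
     auto simp: restriction_def fun_eq_iff cocycle_of_def rep_class)

lemma restriction_zero: "restriction \<zero>\<^bsub>D\<^esub> = \<zero>\<^bsub>N\<^esub>"
  by (auto simp: restriction_def fun_eq_iff cocycle_of_def rep_class)

lemma extension_in_Der: "\<phi> \<in> carrier N \<Longrightarrow> extension \<phi> \<in> carrier D"
  unfolding extension_def by (intro derivation_of_in_Der cocycle_extension)

lemma N_eqI:
  assumes "\<phi> \<in> carrier N" "\<psi> \<in> carrier N"
    and "\<And>K z. K \<in> conjugacy_classes G \<Longrightarrow> z \<in> carrier (Z K) \<Longrightarrow> \<phi> K z = \<psi> K z"
  shows "\<phi> = \<psi>"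
proof (rule PiE_ext[OF assms(1)[unfolded carrier_N] assms(2)[unfolded carrier_N]])
  fix K assume K: "K \<in> conjugacy_classes G"
  then have "\<phi> K \<in> extensional (carrier (Z K))" "\<psi> K \<in> extensional (carrier (Z K))"
    using assms(1,2) unfolding carrier_N by auto
  then show "\<phi> K = \<psi> K"
    using assms(3)[OF K] by (rule extensionalityI)
qed

lemma restriction_extension:
  assumes \<phi>: "\<phi> \<in> carrier N"
  shows "restriction (extension \<phi>) = \<phi>"
proof (rule N_eqI[OF restriction_closed[OF extension_in_Der[OF \<phi>]] \<phi>])
  fix K z assume K: "K \<in> conjugacy_classes G" and z: "z \<in> carrier (Z K)"
  define u t where "u = rep K" and "t = conjugator u"
  have u: "u \<in> carrier G" "conjugacy_class u = K"
    using rep_class[OF K] by (simp_all add: u_def)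
  have zu: "z \<in> carrier G" "z \<otimes> u = u \<otimes> z"
    using z by (simp_all add: u_def)
  \<comment> \<open>The conjugator of a representative need not be the identity; it is only known to
    commute with \<open>u\<close>.\<close>
  have t: "t \<in> carrier (Z K)"
    using conjugator[OF u(1)] by (simp add: t_def u(2) flip: u_def)
  then have [simp]: "t \<in> carrier G" by simp
  have "inv z \<otimes> u \<otimes> z = u"
    using zu u(1) by (simp add: G.m_assoc flip: zu(2))
  then have transport: "transport z u = inv t \<otimes> z \<otimes> t"
    by (simp add: transport_def t_def)
  have tr: "transport z u \<in> carrier (Z K)"
    using transport_in_centralizer[OF zu(1) u(1)] u(2) by simp
  \<comment> \<open>Applying \<open>\<phi> K\<close> to both sides and cancelling
    \<open>\<phi> K t\<close> works because addition in \<open>A\<close> is commutative: a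
    homomorphism to \<open>A\<close> does not see conjugation by \<open>t\<close>.\<close>
  have "t \<otimes> transport z u = z \<otimes> t"
    using zu(1) by (simp add: transport G.m_assoc)
  then have "\<phi> K t \<oplus>\<^bsub>A\<^esub> \<phi> K (transport z u) = \<phi> K z \<oplus>\<^bsub>A\<^esub> \<phi> K t"
    using N_D(2)[OF \<phi> K t tr] N_D(2)[OF \<phi> K z t] by simp
  then have "\<phi> K (transport z u) = \<phi> K z"
    using N_D(1)[OF \<phi> K t] N_D(1)[OF \<phi> K tr] N_D(1)[OF \<phi> K z]
    by (simp add: A.a_comm[of "\<phi> K z"])
  moreover have "restriction (extension \<phi>) K z = \<phi> K (transport z u)"
    using zu(1) u by (simp add: restriction_apply[OF K z] cocycle_of_def extension_basis[OF \<phi>] flip: u_def)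
  ultimately show "restriction (extension \<phi>) K z = \<phi> K z" by simp
qed

text \<open>\<open>restriction\<close> is onto because \<open>extension\<close> is a right inverse,
  so the axioms pass from \<open>D\<close> to \<open>N\<close>. The linearity of
  \<open>extension\<close> is proved afterwards, as it uses that \<open>N\<close> is closed under
  its operations.\<close>

sublocale N: module A N
proof (rule module_surj_image[OF module_Der restriction_hom])
  show "restriction \<zero>\<^bsub>D\<^esub> = \<zero>\<^bsub>N\<^esub>"
    by (rule restriction_zero)
  show "restriction ` carrier D = carrier N"
  proof (intro equalityI subsetI)
    fix \<phi> assume "\<phi> \<in> carrier N"
    then show "\<phi> \<in> restriction ` carrier D"
      using restriction_extension extension_in_Der by (intro image_eqI[of _ _ "extension \<phi>"]) auto
  qed (auto simp: restriction_closed simp del: direct_sum_module_simps)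
qed

text \<open>Both sides are derivations, so they are compared on group elements, where
  \<open>extension_basis\<close> makes the value a pointwise expression in
  \<open>\<phi>\<close>.\<close>

lemma extension_hom: "extension \<in> module_hom A N D"
proof (rule module_homI)
  fix \<phi> \<psi> assume \<phi>: "\<phi> \<in> carrier N" and \<psi>: "\<psi> \<in> carrier N"
  note sum = N.M.a_closed[OF \<phi> \<psi>]
  note in_Der = extension_in_Der[OF \<phi>] extension_in_Der[OF \<psi>]
  show "extension (\<phi> \<oplus>\<^bsub>N\<^esub> \<psi>) = extension \<phi> \<oplus>\<^bsub>D\<^esub> extension \<psi>"
  proof (rule Der_eqI[OF extension_in_Der[OF sum] D.M.a_closed[OF in_Der]])
    fix g k assume "g \<in> carrier G" "k \<in> carrier G"
    then show "extension (\<phi> \<oplus>\<^bsub>N\<^esub> \<psi>) (b g) k = (extension \<phi> \<oplus>\<^bsub>D\<^esub> extension \<psi>) (b g) k"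
      using transport_in_centralizer[of g "k \<otimes> inv g"] extension_basis[OF sum, of g k]
      by (simp add: extension_basis[OF \<phi>] extension_basis[OF \<psi>] del: centralizer_simps)
  qed
next
  fix c \<phi> assume c: "c \<in> carrier A" and \<phi>: "\<phi> \<in> carrier N"
  note smult = N.smult_closed[OF c \<phi>]
  show "extension (c \<odot>\<^bsub>N\<^esub> \<phi>) = c \<odot>\<^bsub>D\<^esub> extension \<phi>"
  proof (rule Der_eqI[OF extension_in_Der[OF smult] D.smult_closed[OF c extension_in_Der[OF \<phi>]]])
    fix g k assume "g \<in> carrier G" "k \<in> carrier G"
    then show "extension (c \<odot>\<^bsub>N\<^esub> \<phi>) (b g) k = (c \<odot>\<^bsub>D\<^esub> extension \<phi>) (b g) k"
      using transport_in_centralizer[of g "k \<otimes> inv g"] extension_basis[OF smult, of g k]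
      by (simp add: extension_basis[OF \<phi>] del: centralizer_simps)
  qed
qed (rule extension_in_Der)

section \<open>The kernel of restriction\<close>

lemma restriction_ad:
  assumes a: "a \<in> carrier G"
  shows "restriction (ad B (b a)) = \<zero>\<^bsub>N\<^esub>"
proof (rule N_eqI[OF restriction_closed[OF ad_basis(1)[OF a]] N.M.zero_closed])
  fix K z assume K: "K \<in> conjugacy_classes G" and z: "z \<in> carrier (Z K)"
  define u where "u = rep K"
  have u: "u \<in> carrier G" "z \<in> carrier G" "z \<otimes> u = u \<otimes> z"
    using rep_class(1)[OF K] z by (simp_all add: u_def)
  \<comment> \<open>The restricted value is the coefficient of \<open>b z\<close> at
    \<open>inv a \<otimes> (u \<otimes> z)\<close> minus the one at
    \<open>u \<otimes> z \<otimes> inv a\<close>. Since \<open>z\<close> commutes with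
    \<open>u\<close>, both are the indicator of \<open>a = u\<close> and cancel.\<close>
  have "inv a \<otimes> (u \<otimes> z) = z \<longleftrightarrow> a = u"
    using u(1,2) a
    by (metis G.inv_solve_left G.m_closed G.right_cancel)
  moreover have "u \<otimes> z \<otimes> inv a = z \<longleftrightarrow> a = u"
    using u(1,2) a unfolding u(3)[symmetric]
    by (metis G.inv_solve_right G.m_closed G.Units_l_cancel G.Units_eq)
  ultimately show "restriction (ad B (b a)) K z = \<zero>\<^bsub>N\<^esub> K z"
    using u a K z
    by (simp add: restriction_apply[OF K z] cocycle_of_def ad_basis(2) a_minus_def A.r_neg flip: u_def)
qed

lemma restriction_group_hom: "abelian_group_hom D N restriction"
  by (rule abelian_group_homI2)
    (simp_all add: D.M.abelian_group_axioms N.M.abelian_group_axioms module_homD[OF restriction_hom]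
      restriction_closed del: direct_sum_module_simps)

text \<open>Restriction is linear and kills every \<open>ad B (b a)\<close>, hence every linear
  combination of them.\<close>

lemma inner_derivation_restriction:
  assumes "d \<in> inner_derivations A G"
  shows "d \<in> carrier D" "restriction d = \<zero>\<^bsub>N\<^esub>"
proof -
  obtain F C where F: "finite F" "F \<subseteq> carrier G" and C: "C \<in> F \<rightarrow> carrier A"
    and d: "d = (\<Oplus>\<^bsub>D\<^esub>a\<in>F. C a \<odot>\<^bsub>D\<^esub> ad B (b a))"
    using assms by (auto simp: inner_derivations_def)
  have summand: "C a \<odot>\<^bsub>D\<^esub> ad B (b a) \<in> carrier D" if "a \<in> F" for a
    using that F C by (intro D.smult_closed ad_basis(1)) auto
  then show "d \<in> carrier D"
    unfolding d by (intro D.M.finsum_closed) auto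
  have "restriction d = (\<Oplus>\<^bsub>N\<^esub>a\<in>F. restriction (C a \<odot>\<^bsub>D\<^esub> ad B (b a)))"
    unfolding d using summand by (intro abelian_group_hom.hom_finsum[OF restriction_group_hom]) auto
  also have "\<dots> = \<zero>\<^bsub>N\<^esub>"
  proof (rule N.M.add.finprod_one_eqI)
    fix a assume "a \<in> F"
    then have "C a \<in> carrier A" "a \<in> carrier G"
      using F C by auto
    then show "restriction (C a \<odot>\<^bsub>D\<^esub> ad B (b a)) = \<zero>\<^bsub>N\<^esub>"
      by (simp only: module_homD(3)[OF restriction_hom] ad_basis(1) restriction_ad N.smult_r_null)
  qed
  finally show "restriction d = \<zero>\<^bsub>N\<^esub>" .
qed

text \<open>The element \<open>t \<otimes> transport g x = g \<otimes> s\<close> is expanded by the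
  cocycle identity in two ways. The first product gives \<open>f t x\<close> alone, because
  \<open>f\<close> vanishes at the transported element and \<open>u\<close>; the second gives
  \<open>f g x\<close> plus \<open>f s y\<close>.\<close>

lemma coboundary_if_restriction_zero:
  assumes d: "d \<in> carrier D" and zero: "restriction d = \<zero>\<^bsub>N\<^esub>"
    and g: "g \<in> carrier G" and x: "x \<in> carrier G"
  shows "cocycle_of d g x = cocycle_of d (conjugator x) x
    \<ominus>\<^bsub>A\<^esub> cocycle_of d (conjugator (inv g \<otimes> x \<otimes> g)) (inv g \<otimes> x \<otimes> g)"
proof -
  define f where "f = cocycle_of d"
  define y u s t where "y = inv g \<otimes> x \<otimes> g" and "u = rep (conjugacy_class x)"
    and "s = conjugator y" and "t = conjugator x"
  note f = cocycleD[OF cocycle_cocycle_of[OF d], folded f_def]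
  have [simp]: "y \<in> carrier G" "u \<in> carrier G" "s \<in> carrier G" "t \<in> carrier G"
    using g x by (simp_all add: y_def u_def s_def t_def rep_class conjugator)
  have tr: "transport g x \<in> carrier (Z (conjugacy_class x))"
    using g x by (rule transport_in_centralizer)
  then have [simp]: "transport g x \<in> carrier G" by simp
  have "restriction d (conjugacy_class x) (transport g x) = \<zero>\<^bsub>A\<^esub>"
    using x tr by (simp add: zero)
  then have f_tr: "f (transport g x) u = \<zero>\<^bsub>A\<^esub>"
    using x tr by (simp add: restriction_apply f_def u_def del: centralizer_simps)
  have tu: "t \<otimes> u = x \<otimes> t"
    using conjugator(2)[OF x] by (simp add: t_def u_def)
  have "inv t \<otimes> x \<otimes> t = u"
    using x by (simp add: G.m_assoc flip: tu)
  then have "f (t \<otimes> transport g x) x = f t x"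
    using x by (simp add: f f_tr)
  moreover have "t \<otimes> transport g x = g \<otimes> s"
    using g by (simp add: transport_def G.m_assoc flip: t_def y_def s_def)
  ultimately have "f g x \<oplus>\<^bsub>A\<^esub> f s y = f t x"
    using g x by (simp add: f flip: y_def)
  then have "f t x \<ominus>\<^bsub>A\<^esub> f s y = (f g x \<oplus>\<^bsub>A\<^esub> f s y) \<ominus>\<^bsub>A\<^esub> f s y"
    by simp
  also have "\<dots> = f g x"
    using g x by (simp add: f a_minus_def A.a_assoc A.r_neg)
  finally show ?thesis
    by (simp add: f_def s_def t_def y_def)
qed

lemma inner_if_restriction_zero:
  assumes d: "d \<in> carrier D" and zero: "restriction d = \<zero>\<^bsub>N\<^esub>"
  shows "d \<in> inner_derivations A G"
proof -
  \<comment> \<open>The cocycle of \<open>d\<close> is the coboundary of this function. As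
    \<open>ad B (b a)\<close> belongs to the coboundary of the indicator of \<open>a\<close>, the
    values \<open>C a\<close> are the coefficients to take.\<close>
  define C where "C a = cocycle_of d (conjugator a) a" for a
  have C: "C a \<in> carrier A" if "a \<in> carrier G" for a
    using that cocycleD(1)[OF cocycle_cocycle_of[OF d]] conjugator(1) by (simp add: C_def)
  have summand: "C a \<odot>\<^bsub>D\<^esub> ad B (b a) \<in> carrier D" if "a \<in> carrier G" for a
    using that by (intro D.smult_closed C ad_basis(1))
  let ?e = "\<Oplus>\<^bsub>D\<^esub>a\<in>carrier G. C a \<odot>\<^bsub>D\<^esub> ad B (b a)"
  have "d = ?e"
  proof (rule Der_eqI[OF d])
    show "?e \<in> carrier D"
      using summand by (intro D.M.finsum_closed) auto
    fix g k assume g: "g \<in> carrier G" and k: "k \<in> carrier G"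
    \<comment> \<open>For fixed \<open>g\<close> and \<open>k\<close> only two indices contribute:
      \<open>k \<otimes> inv g\<close> from the left multiplication and
      \<open>inv g \<otimes> k\<close> from the right one.\<close>
    have 1: "inv a \<otimes> k = g \<longleftrightarrow> a = k \<otimes> inv g" if "a \<in> carrier G" for a
      using g k that by (auto simp: G.inv_mult_group G.m_assoc)
    have 2: "k \<otimes> inv a = g \<longleftrightarrow> a = inv g \<otimes> k" if "a \<in> carrier G" for a
      using g k that by (auto simp: G.inv_mult_group G.m_assoc)
    have "?e (b g) k = (\<Oplus>\<^bsub>A\<^esub>a\<in>carrier G. (C a \<odot>\<^bsub>D\<^esub> ad B (b a)) (b g) k)"
      using summand k by (intro abelian_group_hom.hom_finsum[OF Der_coefficient_hom]) auto
    also have "\<dots> = (\<Oplus>\<^bsub>A\<^esub>a\<in>carrier G. (if a = k \<otimes> inv g then C a else \<zero>\<^bsub>A\<^esub>) \<oplus>\<^bsub>A\<^esub>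
          (if a = inv g \<otimes> k then \<ominus>\<^bsub>A\<^esub> C a else \<zero>\<^bsub>A\<^esub>))"
      using g k
      by (intro A.finsum_cong')
        (auto simp: ad_basis(2) 1 2 C a_minus_def A.r_distr A.r_minus)
    also have "\<dots> = (\<Oplus>\<^bsub>A\<^esub>a\<in>carrier G. if a = k \<otimes> inv g then C a else \<zero>\<^bsub>A\<^esub>) \<oplus>\<^bsub>A\<^esub>
          (\<Oplus>\<^bsub>A\<^esub>a\<in>carrier G. if a = inv g \<otimes> k then \<ominus>\<^bsub>A\<^esub> C a else \<zero>\<^bsub>A\<^esub>)"
      by (intro A.finsum_addf) (auto simp: C)
    also have "(\<Oplus>\<^bsub>A\<^esub>a\<in>carrier G. if a = k \<otimes> inv g then C a else \<zero>\<^bsub>A\<^esub>) = C (k \<otimes> inv g)"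
      using g k by (subst A.finsum_eq_single[where i = "k \<otimes> inv g"]) (auto simp: C)
    also have "(\<Oplus>\<^bsub>A\<^esub>a\<in>carrier G. if a = inv g \<otimes> k then \<ominus>\<^bsub>A\<^esub> C a else \<zero>\<^bsub>A\<^esub>) = \<ominus>\<^bsub>A\<^esub> C (inv g \<otimes> k)"
      using g k by (subst A.finsum_eq_single[where i = "inv g \<otimes> k"]) (auto simp: C)
    \<comment> \<open>The coboundary formula at \<open>x = k \<otimes> inv g\<close>, for which
      \<open>inv g \<otimes> x \<otimes> g\<close> is \<open>inv g \<otimes> k\<close>.\<close>
    also have "C (k \<otimes> inv g) \<oplus>\<^bsub>A\<^esub> \<ominus>\<^bsub>A\<^esub> C (inv g \<otimes> k) = cocycle_of d g (k \<otimes> inv g)"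
      using coboundary_if_restriction_zero[OF d zero g, of "k \<otimes> inv g"] g k
      by (simp add: C_def a_minus_def G.m_assoc)
    also have "\<dots> = d (b g) k"
      using g k by (simp add: cocycle_of_def)
    finally show "d (b g) k = ?e (b g) k" by simp
  qed
  then show ?thesis
    unfolding inner_derivations_def using C
    by (intro CollectI exI[of _ D] exI[of _ "carrier G"] exI[of _ C]) auto
qed

sublocale restriction: split_epimorphism A D N restriction extension
  using restriction_hom extension_hom restriction_extension restriction_zero
  by unfold_locales

lemma kernel_restriction: "{d \<in> carrier D. restriction d = \<zero>\<^bsub>N\<^esub>} = inner_derivations A G"
  using inner_derivation_restriction inner_if_restriction_zero by blast

text \<open>Once the kernel of \<open>restriction\<close> is rewritten as the set of inner
  derivations, the kernel submodule and the quotient by it are literally \<open>Inn\<close> and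
  \<open>Out\<close>.\<close>

lemmas Der_isomorphic = restriction.isomorphic_kernel_sum[unfolded kernel_restriction, folded Inn_def]
  and Out_isomorphic = restriction.quotient_kernel_isomorphic[unfolded kernel_restriction, folded Out_def]

end

theorem theorem4p1:
  fixes G :: "('g, 'n) monoid_scheme" and A :: "('a, 'm) ring_scheme" and rep :: "'g set \<Rightarrow> 'g"
  assumes "group G" and "finite (carrier G)" and "cring A"
    and "\<And>K. K \<in> conjugacy_classes G \<Longrightarrow> rep K \<in> K"
  shows "module_isomorphic A (Der A (group_ring A G))
           (binary_sum_module (Inn A G)
             (direct_sum_module (conjugacy_classes G) (\<lambda>K. Hom_Ab (centralizer G (rep K)) A)))
       \<and> module_isomorphic A (Out A G)
           (direct_sum_module (conjugacy_classes G) (\<lambda>K. Hom_Ab (centralizer G (rep K)) A))"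
proof -
  interpret conjugacy_representatives G A rep
    using assms
    by (intro conjugacy_representatives.intro finite_group_algebra.intro
        finite_group_algebra_axioms.intro conjugacy_representatives_axioms.intro)
  show ?thesis
    using Der_isomorphic Out_isomorphic by (rule conjI)
qed

end
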